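(* A PIN model defined on a graph $\mathcal G=(\mathcal M,\mathcal E)$ (a 2-uniform hypergraph) is $R_{\mathrm{SK}}$-maximal if and only if it is Type $\mathcal S$.
   Context: Setup. Let $\mathcal M=\{1,\dots,m\}$, $m\ge2$. Entropies are base 2. $X_A=(X_i:i\in A)$. PIN model. Given $\mathcal G=(\mathcal M,\mathcal E)$ with $\mathcal E$ a finite multiset of 2-element subsets of $\mathcal M$, let $\mathcal E^{(n)}$ contain $n$ copies of each edge. Each $e\in\mathcal E^{(n)}$ carries an independent Bernoulli(1/2) variable $\xi_e$, and terminal $i$ observes $X^n_i=(\xi_e:e\in\mathcal E^{(n)},\ i\in e)$. Interactive communication, CR, SK. An interactive communication $\mathbf F$ (range $\mathcal F$) is a finite sequence of transmissions, each a deterministic function of the sender's $X^n_i$ and earlier transmissions. A CR from $\mathbf F$ is a sequence $\mathbf J$ of functions of $X^n_{\mathcal M}$ such that for every $0<\epsilon<1$ and large $n$, every terminal $i$ can compute $J_i(X^n_i,\mathbf F)$ with $\Pr[J_1=\cdots=J_m=\mathbf J]\ge1-\epsilon$. An SK is such a CR $\mathbf K$ with $I(\mathbf K;\mathbf F)\le\epsilon$ for all large $n$, for each $\epsilon>0$. Multipartite information and Type $\mathcal S$. $\Delta(\mathcal P)=\frac1{|\mathcal P|-1}[\sum_{A\in\mathcal P}H(X_A)-H(X_{\mathcal M})]$ for partitions with $\ge2$ cells, and $\mathbf I(X_{\mathcal M})=\min_{\mathcal P}\Delta(\mathcal P)$ (the SK capacity). The model is Type $\mathcal S$ if the singleton partition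 $\{\{1\},\dots,\{m\}\}$ attains this minimum. Communication rates. $R_{\mathrm{CO}}=\min\{\sum_iR_i:\sum_{i\in B}R_i\ge H(X_B|X_{B^c})\ \forall\emptyset\neq B\subsetneq\mathcal M\}$. $R_{\mathrm{SK}}$ is the infimum of $R\ge0$ such that for every $\epsilon>0$ and large $n$ there exist $\mathbf F$ with $\frac1n\log|\mathcal F|\le R+\epsilon$ and an SK $\mathbf K$ from $\mathbf F$ with $\frac1nH(\mathbf K)\ge\mathbf I(X_{\mathcal M})-\epsilon$. The source is $R_{\mathrm{SK}}$-maximal if $R_{\mathrm{SK}}=R_{\mathrm{CO}}$. *)

theory Defs
  imports Complex_Main "HOL-Library.Disjoint_Sets"
begin

text \<open>
PIN model on a graph. Terminals are 1..m. The (multi)set of edges is given as a finite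
family of edge labels E :: 'e set together with their endpoints ends e (a 2-element subset
of {1..m}); distinct labels may have the same endpoints, so multi-edges are allowed.
The n copies of an edge e are the pairs (e,k), k < n. A realisation of all edge bits at
blocklength n is a function xi :: ('e * nat) => bool vanishing outside E x {..<n};
these realisations are uniformly distributed (i.i.d. fair bits).
\<close>

type_synonym 'e sample = "'e \<times> nat \<Rightarrow> bool"

definition sample_space :: "'e set \<Rightarrow> nat \<Rightarrow> 'e sample set" where
  "sample_space E n = {xi. \<forall>x. xi x \<longrightarrow> x \<in> E \<times> {..<n}}"

definition copies :: "'e set \<Rightarrow> ('e \<Rightarrow> nat set) \<Rightarrow> nat \<Rightarrow> nat set \<Rightarrow> ('e \<times> nat) set" where
  "copies E ends n A = {(e, k). e \<in> E \<and> ends e \<inter> A \<noteq> {} \<and> k < n}"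

definition obs :: "'e set \<Rightarrow> ('e \<Rightarrow> nat set) \<Rightarrow> nat \<Rightarrow> nat set \<Rightarrow> 'e sample \<Rightarrow> 'e sample" where
  "obs E ends n A xi = (\<lambda>x. if x \<in> copies E ends n A then xi x else False)"

definition unif_prob :: "'w set \<Rightarrow> ('w \<Rightarrow> bool) \<Rightarrow> real" where
  "unif_prob \<Omega> P = real (card {w \<in> \<Omega>. P w}) / real (card \<Omega>)"

definition ent :: "'w set \<Rightarrow> ('w \<Rightarrow> 'v) \<Rightarrow> real" where
  "ent \<Omega> f = (\<Sum>v \<in> f ` \<Omega>. - unif_prob \<Omega> (\<lambda>w. f w = v) * log 2 (unif_prob \<Omega> (\<lambda>w. f w = v)))"

definition cond_ent :: "'w set \<Rightarrow> ('w \<Rightarrow> 'v) \<Rightarrow> ('w \<Rightarrow> 'u) \<Rightarrow> real" where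
  "cond_ent \<Omega> f g = ent \<Omega> (\<lambda>w. (f w, g w)) - ent \<Omega> g"

definition mut_info :: "'w set \<Rightarrow> ('w \<Rightarrow> 'v) \<Rightarrow> ('w \<Rightarrow> 'u) \<Rightarrow> real" where
  "mut_info \<Omega> f g = ent \<Omega> f + ent \<Omega> g - ent \<Omega> (\<lambda>w. (f w, g w))"

definition H_X :: "'e set \<Rightarrow> ('e \<Rightarrow> nat set) \<Rightarrow> nat set \<Rightarrow> real" where
  "H_X E ends A = ent (sample_space E 1) (obs E ends 1 A)"

definition H_cond :: "'e set \<Rightarrow> ('e \<Rightarrow> nat set) \<Rightarrow> nat set \<Rightarrow> nat set \<Rightarrow> real" where
  "H_cond E ends B C = cond_ent (sample_space E 1) (obs E ends 1 B) (obs E ends 1 C)"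

definition terminals :: "nat \<Rightarrow> nat set" where
  "terminals m = {1..m}"

definition Delta :: "'e set \<Rightarrow> ('e \<Rightarrow> nat set) \<Rightarrow> nat \<Rightarrow> nat set set \<Rightarrow> real" where
  "Delta E ends m P =
     ((\<Sum>A\<in>P. H_X E ends A) - H_X E ends (terminals m)) / (real (card P) - 1)"

definition MI :: "'e set \<Rightarrow> ('e \<Rightarrow> nat set) \<Rightarrow> nat \<Rightarrow> real" where
  "MI E ends m = Min {Delta E ends m P | P. partition_on (terminals m) P \<and> card P \<ge> 2}"

definition singleton_partition :: "nat \<Rightarrow> nat set set" where
  "singleton_partition m = (\<lambda>i. {i}) ` terminals m"

definition type_S :: "'e set \<Rightarrow> ('e \<Rightarrow> nat set) \<Rightarrow> nat \<Rightarrow> bool" where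
  "type_S E ends m \<longleftrightarrow> Delta E ends m (singleton_partition m) = MI E ends m"

definition R_CO :: "'e set \<Rightarrow> ('e \<Rightarrow> nat set) \<Rightarrow> nat \<Rightarrow> real" where
  "R_CO E ends m = Inf {(\<Sum>i\<in>terminals m. R i) | R :: nat \<Rightarrow> real.
      \<forall>B. B \<noteq> {} \<and> B \<subset> terminals m \<longrightarrow>
          (\<Sum>i\<in>B. R i) \<ge> H_cond E ends B (terminals m - B)}"

text \<open>Interactive communication: a finite list of transmissions (sender, rule); each
transmission is a deterministic function of the sender's observation X^n_i and of the list of
earlier transmissions. Messages are natural numbers; the transcript is the list of messages.\<close>
type_synonym 'e protocol = "(nat \<times> ('e sample \<Rightarrow> nat list \<Rightarrow> nat)) list"

primrec run :: "'e set \<Rightarrow> ('e \<Rightarrow> nat set) \<Rightarrow> nat \<Rightarrow> 'e protocol \<Rightarrow> 'e sample \<Rightarrow> nat list \<Rightarrow> nat list" where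
  "run E ends n [] xi acc = acc"
| "run E ends n (t # ts) xi acc =
     run E ends n ts xi (acc @ [snd t (obs E ends n {fst t} xi) acc])"

definition transcript :: "'e set \<Rightarrow> ('e \<Rightarrow> nat set) \<Rightarrow> nat \<Rightarrow> 'e protocol \<Rightarrow> 'e sample \<Rightarrow> nat list" where
  "transcript E ends n F xi = run E ends n F xi []"

definition valid_protocol :: "nat \<Rightarrow> 'e protocol \<Rightarrow> bool" where
  "valid_protocol m F \<longleftrightarrow> (\<forall>t \<in> set F. fst t \<in> terminals m)"

definition SK_achievable :: "'e set \<Rightarrow> ('e \<Rightarrow> nat set) \<Rightarrow> nat \<Rightarrow> real \<Rightarrow> bool" where
  "SK_achievable E ends m R \<longleftrightarrow>
    (\<exists>(Fs :: nat \<Rightarrow> 'e protocol) (Ks :: nat \<Rightarrow> 'e sample \<Rightarrow> nat)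
       (Js :: nat \<Rightarrow> nat \<Rightarrow> 'e sample \<Rightarrow> nat list \<Rightarrow> nat).
      (\<forall>n. valid_protocol m (Fs n)) \<and>
      (\<forall>\<epsilon>>0. eventually (\<lambda>n.
          log 2 (real (card (transcript E ends n (Fs n) ` sample_space E n))) / real n \<le> R + \<epsilon>
        \<and> unif_prob (sample_space E n)
            (\<lambda>xi. \<forall>i\<in>terminals m.
               Js n i (obs E ends n {i} xi) (transcript E ends n (Fs n) xi) = Ks n xi) \<ge> 1 - \<epsilon>
        \<and> mut_info (sample_space E n) (Ks n) (transcript E ends n (Fs n)) \<le> \<epsilon>
        \<and> ent (sample_space E n) (Ks n) / real n \<ge> MI E ends m - \<epsilon>) sequentially))"

definition R_SK :: "'e set \<Rightarrow> ('e \<Rightarrow> nat set) \<Rightarrow> nat \<Rightarrow> real" where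
  "R_SK E ends m = Inf {R. R \<ge> 0 \<and> SK_achievable E ends m R}"

definition RSK_maximal :: "'e set \<Rightarrow> ('e \<Rightarrow> nat set) \<Rightarrow> nat \<Rightarrow> bool" where
  "RSK_maximal E ends m \<longleftrightarrow> R_SK E ends m = R_CO E ends m"

end

theory Submission
  imports Defs "HOL-Library.Countable"
begin

text \<open>
For every graph, \<open>R\<^sub>S\<^sub>K = (m - 2) I\<close>, where \<open>I\<close> is the multipartite information.
Upper bound: multiplicative weights pack about \<open>n I\<close> spanning trees into the \<open>n\<close>-fold multigraph, and
each tree yields one perfectly secret bit for \<open>m - 2\<close> public bits.
Lower bound: for \<open>L = (K, F)\<close> the inequality \<open>(\<Sum>i. H(X\<^sub>i | L)) \<ge> 2 H(X | L)\<close> (each edge is seen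
twice), Fano, and \<open>H(F) \<le> (\<Sum>i. I(F; X\<^sub>i))\<close> for interactive \<open>F\<close> give \<open>(m - 2) H(K | F) \<le> H(F) + o(n)\<close>.
On the other hand \<open>R\<^sub>C\<^sub>O \<ge> \<bar>E\<bar> - I\<close>, with equality for Type \<open>S\<close> (rates \<open>deg i - I\<close>), and
\<open>\<bar>E\<bar> \<ge> (m - 1) I\<close> with equality exactly for Type \<open>S\<close>.
\<close>

section \<open>Entropy on a finite uniform space\<close>

text \<open>The factor \<open>m - 2\<close> arises in two ways that match. A spanning tree carries
  \<open>m - 1\<close> independent bits, of which one is kept and the others are published. In the
  converse every one of the \<open>m\<close> terminals recovers the key, while the edge inequality
  accounts for it only twice; the difference has to be paid by communication. \<open>I\<close> is
  the minimum of (edges between classes) / (classes - 1), the ratio of the Nash-Williams-Tutte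
  theorem, and in general not an integer. Since \<open>SK_achievable\<close> is asymptotic, a
  packing of \<open>n * (I - \<epsilon>)\<close> trees into \<open>n\<close> copies of the graph
  suffices, and this is a fractional statement: by linear programming duality it amounts to finding,
  for all nonnegative edge weights, a tree of weight at most the total divided by \<open>I\<close>.
  Multiplicative weights turn such trees into an explicit packing. Partitions are handled as
  colourings of the terminals, so that merging two cells is a recolouring and the search for a light
  tree can be an induction on the number of colours.\<close>

lemma unif_prob_nonneg: "0 \<le> unif_prob \<Omega> P"
  by (simp add: unif_prob_def)

lemma unif_prob_pos:
  assumes "finite \<Omega>" "w \<in> \<Omega>" "P w"
  shows "0 < unif_prob \<Omega> P"
proof -
  have "card {w \<in> \<Omega>. P w} > 0" "card \<Omega> > 0"
    using assms by (auto simp: card_gt_0_iff)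
  then show ?thesis by (simp add: unif_prob_def)
qed

lemma unif_prob_mono:
  assumes "finite \<Omega>" "\<And>w. w \<in> \<Omega> \<Longrightarrow> P w \<Longrightarrow> Q w"
  shows "unif_prob \<Omega> P \<le> unif_prob \<Omega> Q"
  unfolding unif_prob_def using assms
  by (intro divide_right_mono) (auto intro!: card_mono)

lemma unif_prob_sum_image:
  fixes f :: "'w \<Rightarrow> 'a" and \<phi> :: "'a \<Rightarrow> real"
  assumes "finite \<Omega>"
  shows "(\<Sum>v\<in>f ` \<Omega>. unif_prob \<Omega> (\<lambda>w. f w = v) * \<phi> v) = (\<Sum>w\<in>\<Omega>. \<phi> (f w)) / card \<Omega>"
proof -
  have "(\<Sum>w\<in>\<Omega>. \<phi> (f w)) = (\<Sum>v\<in>f ` \<Omega>. \<Sum>w\<in>{w \<in> \<Omega>. f w = v}. \<phi> (f w))"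
    using assms by (rule sum.image_gen)
  also have "\<dots> = (\<Sum>v\<in>f ` \<Omega>. card {w \<in> \<Omega>. f w = v} * \<phi> v)"
    by (intro sum.cong) auto
  finally show ?thesis
    by (simp add: unif_prob_def sum_divide_distrib)
qed

lemma unif_prob_marginal:
  assumes "finite \<Omega>"
  shows "(\<Sum>a\<in>f ` \<Omega>. unif_prob \<Omega> (\<lambda>w. (f w, h w) = (a, c))) = unif_prob \<Omega> (\<lambda>w. h w = c)"
proof -
  let ?S = "{w \<in> \<Omega>. h w = c}"
  have "(\<Sum>a\<in>f ` \<Omega>. \<Sum>w\<in>{w \<in> ?S. f w = a}. 1 :: real) = (\<Sum>w\<in>?S. 1)"
    using assms by (intro sum.group) auto
  moreover have "{w \<in> ?S. f w = a} = {w \<in> \<Omega>. (f w, h w) = (a, c)}" for a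
    by auto
  ultimately have "(\<Sum>a\<in>f ` \<Omega>. real (card {w \<in> \<Omega>. (f w, h w) = (a, c)})) = card ?S"
    by simp
  then show ?thesis
    unfolding unif_prob_def by (simp only: flip: sum_divide_distrib)
qed

lemma unif_prob_sum_1:
  assumes "finite \<Omega>" "\<Omega> \<noteq> {}"
  shows "(\<Sum>v\<in>f ` \<Omega>. unif_prob \<Omega> (\<lambda>w. f w = v)) = 1"
  using unif_prob_sum_image[OF assms(1), of f "\<lambda>_. 1"] assms by simp

text \<open>As an average over outcomes, entropies of functions with different ranges are sums over
  the same index set and can be compared term by term.\<close>

lemma ent_eq_sum:
  assumes "finite \<Omega>"
  shows "ent \<Omega> f = (\<Sum>w\<in>\<Omega>. - log 2 (unif_prob \<Omega> (\<lambda>w'. f w' = f w))) / card \<Omega>"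
  unfolding ent_def
  using unif_prob_sum_image[OF assms, of f "\<lambda>v. - log 2 (unif_prob \<Omega> (\<lambda>w'. f w' = v))"]
  by simp

text \<open>Gibbs' inequality, from \<open>ln x <= x - 1\<close>. Total mass at most 1 is enough for
  \<open>q\<close>. The choice of \<open>q\<close> yields in turn the bound by the range,
  submodularity and Fano's inequality.\<close>

lemma ent_le_cross_entropy:
  assumes "finite \<Omega>" "\<Omega> \<noteq> {}"
    and pos: "\<And>v. v \<in> f ` \<Omega> \<Longrightarrow> 0 < q v" and le1: "(\<Sum>v\<in>f ` \<Omega>. q v) \<le> 1"
  shows "ent \<Omega> f \<le> (\<Sum>w\<in>\<Omega>. - log 2 (q (f w))) / card \<Omega>"
proof -
  define p where "p v = unif_prob \<Omega> (\<lambda>w. f w = v)" for v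
  have ppos: "0 < p v" if "v \<in> f ` \<Omega>" for v
    using that assms(1) by (auto simp: p_def intro!: unif_prob_pos)
  have "ent \<Omega> f - (\<Sum>v\<in>f ` \<Omega>. p v * - log 2 (q v)) = (\<Sum>v\<in>f ` \<Omega>. p v * log 2 (q v / p v))"
    unfolding ent_def p_def[symmetric] sum_subtractf[symmetric]
  proof (intro sum.cong refl)
    fix v assume "v \<in> f ` \<Omega>"
    then show "- p v * log 2 (p v) - p v * - log 2 (q v) = p v * log 2 (q v / p v)"
      using ppos[of v] pos[of v] by (simp add: log_divide algebra_simps)
  qed
  also have "\<dots> \<le> (\<Sum>v\<in>f ` \<Omega>. (q v - p v) / ln 2)"
  proof (intro sum_mono)
    fix v assume v: "v \<in> f ` \<Omega>"
    have "ln (q v / p v) \<le> q v / p v - 1"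
      using ppos[OF v] pos[OF v] by (intro ln_le_minus_one) auto
    then have "p v * ln (q v / p v) \<le> p v * (q v / p v - 1)"
      using ppos[OF v] by (intro mult_left_mono) auto
    also have "\<dots> = q v - p v" using ppos[OF v] by (simp add: field_simps)
    finally show "p v * log 2 (q v / p v) \<le> (q v - p v) / ln 2"
      by (simp add: log_def divide_right_mono)
  qed
  also have "\<dots> = ((\<Sum>v\<in>f ` \<Omega>. q v) - 1) / ln 2"
    using unif_prob_sum_1[OF assms(1,2), of f] by (simp add: p_def sum_subtractf flip: sum_divide_distrib)
  also have "\<dots> \<le> 0" using le1 by (simp add: divide_le_0_iff)
  finally show ?thesis
    using unif_prob_sum_image[OF assms(1), of f "\<lambda>v. - log 2 (q v)"] by (simp add: p_def)
qed

lemma ent_mono: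
  assumes "finite \<Omega>" and det: "\<And>w w'. w \<in> \<Omega> \<Longrightarrow> w' \<in> \<Omega> \<Longrightarrow> f w = f w' \<Longrightarrow> g w = g w'"
  shows "ent \<Omega> g \<le> ent \<Omega> f"
  unfolding ent_eq_sum[OF assms(1)]
proof (intro divide_right_mono sum_mono)
  fix w assume w: "w \<in> \<Omega>"
  have "unif_prob \<Omega> (\<lambda>w'. f w' = f w) \<le> unif_prob \<Omega> (\<lambda>w'. g w' = g w)"
    using assms(1) det[OF _ w] by (intro unif_prob_mono)
  moreover have "0 < unif_prob \<Omega> (\<lambda>w'. f w' = f w)"
    using assms(1) w by (intro unif_prob_pos) auto
  ultimately show "- log 2 (unif_prob \<Omega> (\<lambda>w'. g w' = g w)) \<le> - log 2 (unif_prob \<Omega> (\<lambda>w'. f w' = f w))"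
    by simp
qed simp

text \<open>Entropy depends only on the partition of the space into fibres. This is what regroups
  tuples and drops components determined by the others.\<close>

lemma ent_cong:
  assumes "finite \<Omega>" "\<And>w w'. w \<in> \<Omega> \<Longrightarrow> w' \<in> \<Omega> \<Longrightarrow> f w = f w' \<longleftrightarrow> g w = g w'"
  shows "ent \<Omega> f = ent \<Omega> g"
proof (rule antisym)
  show "ent \<Omega> f \<le> ent \<Omega> g" "ent \<Omega> g \<le> ent \<Omega> f"
    by (rule ent_mono[OF assms(1)]; use assms(2) in blast)+
qed

lemma ent_le_log_card:
  assumes "finite \<Omega>" "\<Omega> \<noteq> {}" "finite S" "f ` \<Omega> \<subseteq> S"
  shows "ent \<Omega> f \<le> log 2 (card S)"
proof -
  have S: "card S > 0" using assms by (auto simp: card_gt_0_iff)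
  have "card (f ` \<Omega>) \<le> card S" using assms by (intro card_mono) auto
  then have "ent \<Omega> f \<le> (\<Sum>w\<in>\<Omega>. - log 2 (1 / real (card S))) / card \<Omega>"
    using S assms by (intro ent_le_cross_entropy[where q = "\<lambda>_. 1 / real (card S)"]) auto
  also have "\<dots> = log 2 (card S)" using assms S by (auto simp: log_divide)
  finally show ?thesis .
qed

lemma ent_id:
  assumes "finite \<Omega>" "\<Omega> \<noteq> {}"
  shows "ent \<Omega> (\<lambda>w. w) = log 2 (card \<Omega>)"
proof -
  have "card \<Omega> > 0" using assms by (auto simp: card_gt_0_iff)
  moreover have "unif_prob \<Omega> (\<lambda>w'. w' = w) = 1 / card \<Omega>" if "w \<in> \<Omega>" for w
  proof -
    have "{w' \<in> \<Omega>. w' = w} = {w}" using that by auto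
    then show ?thesis by (simp add: unif_prob_def)
  qed
  ultimately show ?thesis
    by (simp add: ent_eq_sum[OF assms(1)] log_divide)
qed

text \<open>Nonnegativity of the conditional mutual information of \<open>f\<close> and
  \<open>g\<close> given \<open>h\<close>: Gibbs' inequality for the law \<open>q\<close> that has
  the true pair marginals but makes \<open>f\<close> and \<open>g\<close> conditionally independent
  given \<open>h\<close>.\<close>

lemma ent_submodular:
  assumes "finite \<Omega>" "\<Omega> \<noteq> {}"
  shows "ent \<Omega> (\<lambda>w. (f w, g w, h w)) + ent \<Omega> h \<le> ent \<Omega> (\<lambda>w. (f w, h w)) + ent \<Omega> (\<lambda>w. (g w, h w))"
proof -
  define pf where "pf a c = unif_prob \<Omega> (\<lambda>w. (f w, h w) = (a, c))" for a c
  define pg where "pg b c = unif_prob \<Omega> (\<lambda>w. (g w, h w) = (b, c))" for b c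
  define ph where "ph c = unif_prob \<Omega> (\<lambda>w. h w = c)" for c
  define q where "q = (\<lambda>(a, b, c). pf a c * pg b c / ph c)"
  have pos: "0 < pf (f w) (h w)" "0 < pg (g w) (h w)" "0 < ph (h w)" if "w \<in> \<Omega>" for w
    using that assms(1) by (auto simp: pf_def pg_def ph_def intro!: unif_prob_pos)
  have nn: "0 \<le> q x" for x
    by (auto simp: q_def pf_def pg_def ph_def unif_prob_nonneg split: prod.split)
  \<comment> \<open>\<open>q\<close> may be positive on triples that never occur. Over the full
    product the sum factors for each \<open>c\<close> into
    \<open>ph c * ph c / ph c\<close>.\<close>
  have "(\<Sum>x\<in>(\<lambda>w. (f w, g w, h w)) ` \<Omega>. q x) \<le> (\<Sum>x\<in>f ` \<Omega> \<times> g ` \<Omega> \<times> h ` \<Omega>. q x)"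
    using assms(1) nn by (intro sum_mono2) auto
  also have "\<dots> = (\<Sum>a\<in>f ` \<Omega>. \<Sum>b\<in>g ` \<Omega>. \<Sum>c\<in>h ` \<Omega>. pf a c * pg b c / ph c)"
    by (simp add: q_def flip: sum.cartesian_product)
  also have "\<dots> = (\<Sum>a\<in>f ` \<Omega>. \<Sum>c\<in>h ` \<Omega>. \<Sum>b\<in>g ` \<Omega>. pf a c * pg b c / ph c)"
    by (intro sum.cong refl sum.swap)
  also have "\<dots> = (\<Sum>c\<in>h ` \<Omega>. \<Sum>a\<in>f ` \<Omega>. \<Sum>b\<in>g ` \<Omega>. pf a c * pg b c / ph c)"
    by (rule sum.swap)
  also have "\<dots> = (\<Sum>c\<in>h ` \<Omega>. (\<Sum>a\<in>f ` \<Omega>. pf a c) * (\<Sum>b\<in>g ` \<Omega>. pg b c) / ph c)"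
    by (simp add: sum_product sum_divide_distrib)
  also have "\<dots> = (\<Sum>c\<in>h ` \<Omega>. ph c)"
    unfolding pf_def pg_def ph_def unif_prob_marginal[OF assms(1)]
    by (intro sum.cong) auto
  also have "\<dots> = 1" unfolding ph_def by (rule unif_prob_sum_1[OF assms])
  finally have "ent \<Omega> (\<lambda>w. (f w, g w, h w)) \<le> (\<Sum>w\<in>\<Omega>. - log 2 (q (f w, g w, h w))) / card \<Omega>"
    using assms pos by (intro ent_le_cross_entropy) (auto simp: q_def)
  also have "(\<Sum>w\<in>\<Omega>. - log 2 (q (f w, g w, h w))) =
      (\<Sum>w\<in>\<Omega>. - log 2 (pf (f w) (h w)) + - log 2 (pg (g w) (h w)) - - log 2 (ph (h w)))"
  proof (intro sum.cong refl)
    fix w assume "w \<in> \<Omega>"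
    from pos[OF this] show "- log 2 (q (f w, g w, h w)) =
      - log 2 (pf (f w) (h w)) + - log 2 (pg (g w) (h w)) - - log 2 (ph (h w))"
      by (simp add: q_def log_mult log_divide)
  qed
  finally show ?thesis
    unfolding ent_eq_sum[OF assms(1)] pf_def pg_def ph_def
    by (simp add: sum.distrib sum_subtractf sum_negf diff_divide_distrib add_divide_distrib)
qed

lemma ent_const:
  assumes "finite \<Omega>" "\<Omega> \<noteq> {}"
  shows "ent \<Omega> (\<lambda>_. c) = 0"
  using assms by (simp add: ent_eq_sum unif_prob_def)

lemma ent_subadditive:
  assumes "finite \<Omega>" "\<Omega> \<noteq> {}"
  shows "ent \<Omega> (\<lambda>w. (f w, g w)) \<le> ent \<Omega> f + ent \<Omega> g"
proof -
  have "ent \<Omega> (\<lambda>w. (f w, g w, ())) \<le> ent \<Omega> (\<lambda>w. (f w, ())) + ent \<Omega> (\<lambda>w. (g w, ()))"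
    using ent_submodular[OF assms, of f g "\<lambda>_. ()"] ent_const[OF assms, of "()"] by simp
  also have "ent \<Omega> (\<lambda>w. (f w, g w, ())) = ent \<Omega> (\<lambda>w. (f w, g w))"
    by (rule ent_cong[OF assms(1)]) auto
  also have "ent \<Omega> (\<lambda>w. (f w, ())) = ent \<Omega> f"
    by (rule ent_cong[OF assms(1)]) auto
  also have "ent \<Omega> (\<lambda>w. (g w, ())) = ent \<Omega> g"
    by (rule ent_cong[OF assms(1)]) auto
  finally show ?thesis .
qed

lemma unif_prob_not:
  assumes "finite \<Omega>" "\<Omega> \<noteq> {}"
  shows "unif_prob \<Omega> (\<lambda>w. \<not> P w) = 1 - unif_prob \<Omega> P"
proof -
  have "{w \<in> \<Omega>. \<not> P w} = \<Omega> - {w \<in> \<Omega>. P w}" by auto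
  then have "card {w \<in> \<Omega>. \<not> P w} = card \<Omega> - card {w \<in> \<Omega>. P w}"
    using assms by (simp add: card_Diff_subset)
  moreover have "card {w \<in> \<Omega>. P w} \<le> card \<Omega>" using assms by (intro card_mono) auto
  moreover have "card \<Omega> > 0" using assms by (auto simp: card_gt_0_iff)
  ultimately show ?thesis by (simp add: unif_prob_def of_nat_diff field_simps)
qed

text \<open>The error-marked key \<open>Z\<close> below (\<open>None\<close> when the estimate is right) together with the
  side information determines the key, so only \<open>ent \<Omega> Z\<close> has to be bounded.\<close>

lemma fano:
  assumes "finite \<Omega>" "\<Omega> \<noteq> {}"
    and prob: "unif_prob \<Omega> (\<lambda>w. J (g w) = k w) \<ge> 1 - \<epsilon>"
  shows "ent \<Omega> (\<lambda>w. (k w, g w)) \<le> ent \<Omega> g + 1 + \<epsilon> * log 2 (card \<Omega>)"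
proof -
  define Z where "Z w = (if J (g w) = k w then None else Some (k w))" for w
  define N where "N = real (card \<Omega>)"
  \<comment> \<open>Half of the mass goes to "no error"; the other half is spread over the at most
    \<open>N\<close> key values. The code lengths are therefore \<open>1\<close> and
    \<open>1 + log 2 N\<close>.\<close>
  define q :: "'b option \<Rightarrow> real" where "q z = (if z = None then 1 / 2 else 1 / (2 * N))" for z
  have N: "N \<ge> 1"
    using assms by (simp add: N_def Suc_le_eq card_gt_0_iff)
  have "ent \<Omega> (\<lambda>w. (k w, g w)) \<le> ent \<Omega> (\<lambda>w. (Z w, g w))"
    by (rule ent_mono[OF assms(1)]) (auto simp: Z_def split: if_splits)
  also have "\<dots> \<le> ent \<Omega> Z + ent \<Omega> g" by (rule ent_subadditive[OF assms(1,2)])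
  also have "ent \<Omega> Z \<le> (\<Sum>w\<in>\<Omega>. - log 2 (q (Z w))) / card \<Omega>"
  proof (rule ent_le_cross_entropy[OF assms(1,2)])
    have "(\<Sum>v\<in>Z ` \<Omega>. q v) \<le> (\<Sum>v\<in>insert None (Some ` k ` \<Omega>). q v)"
      using assms(1) N by (intro sum_mono2) (auto simp: Z_def q_def)
    also have "\<dots> = 1 / 2 + card (k ` \<Omega>) / (2 * N)"
      using assms(1) by (subst sum.insert) (auto simp: q_def sum.reindex)
    also have "\<dots> \<le> 1 / 2 + N / (2 * N)"
      using N card_image_le[OF assms(1), of k]
      by (intro add_left_mono divide_right_mono) (auto simp: N_def)
    also have "\<dots> = 1" using N by simp
    finally show "(\<Sum>v\<in>Z ` \<Omega>. q v) \<le> 1" .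
  qed (use N in \<open>auto simp: q_def\<close>)
  also have "(\<Sum>w\<in>\<Omega>. - log 2 (q (Z w))) =
      (\<Sum>w\<in>\<Omega>. 1 + (if J (g w) = k w then 0 else log 2 N))"
    using N by (intro sum.cong) (auto simp: q_def Z_def log_divide log_mult)
  also have "\<dots> = N + log 2 N * card {w \<in> \<Omega>. J (g w) \<noteq> k w}"
    using assms(1) by (simp add: sum.distrib N_def sum.If_cases Int_def Collect_neg_eq)
  also have "\<dots> / card \<Omega> = 1 + log 2 N * unif_prob \<Omega> (\<lambda>w. J (g w) \<noteq> k w)"
    using N by (simp add: unif_prob_def N_def add_divide_distrib)
  also have "unif_prob \<Omega> (\<lambda>w. J (g w) \<noteq> k w) = 1 - unif_prob \<Omega> (\<lambda>w. J (g w) = k w)"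
    by (rule unif_prob_not[OF assms(1,2)])
  also have "1 + log 2 N * (1 - unif_prob \<Omega> (\<lambda>w. J (g w) = k w)) \<le> 1 + log 2 N * \<epsilon>"
    using prob N by (intro add_left_mono mult_left_mono) auto
  finally show ?thesis by (simp add: N_def mult.commute)
qed

section \<open>The edge bits\<close>

text \<open>Generalises \<open>obs\<close> from the copies seen by a set of terminals to any set of
  copies, so that bits can be added one at a time or picked by a tree.\<close>

definition res :: "('e \<times> nat) set \<Rightarrow> 'e sample \<Rightarrow> 'e sample" where
  "res S xi = (\<lambda>x. x \<in> S \<and> xi x)"

lemma obs_eq_res: "obs E ends n A = res (copies E ends n A)"
  by (auto simp: obs_def res_def fun_eq_iff)

lemma sample_space_eq_image: "sample_space E n = (\<lambda>S x. x \<in> S) ` Pow (E \<times> {..<n})"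
proof -
  have "xi \<in> (\<lambda>S x. x \<in> S) ` Pow (E \<times> {..<n})" if "xi \<in> sample_space E n" for xi
    using that by (intro image_eqI[of _ _ "Collect xi"]) (auto simp: sample_space_def)
  then show ?thesis by (auto simp: sample_space_def)
qed

lemma finite_sample_space: "finite E \<Longrightarrow> finite (sample_space E n)"
  by (simp add: sample_space_eq_image)

lemma sample_space_nonempty: "sample_space E n \<noteq> {}"
  by (auto simp: sample_space_eq_image)

lemma card_sample_space: "finite E \<Longrightarrow> card (sample_space E n) = 2 ^ (n * card E)"
  unfolding sample_space_eq_image
  by (subst card_image) (auto simp: inj_on_def fun_eq_iff card_Pow mult.commute)

lemma res_eq_iff: "res S xi = res S xi' \<longleftrightarrow> (\<forall>x\<in>S. xi x = xi' x)"
  by (auto simp: res_def fun_eq_iff)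

lemma sample_ext:
  assumes "xi \<in> sample_space E n" "xi' \<in> sample_space E n" "\<And>x. x \<in> E \<times> {..<n} \<Longrightarrow> xi x = xi' x"
  shows "xi = xi'"
  using assms unfolding sample_space_def by (intro ext) blast

text \<open>The bits in \<open>S\<close> and those outside together determine the sample, whose
  entropy is the total number of bits. Each part has at most its cardinality, so subadditivity
  leaves no slack.\<close>

lemma ent_res:
  assumes "finite E" "S \<subseteq> E \<times> {..<n}"
  shows "ent (sample_space E n) (res S) = card S"
proof -
  note fin = finite_sample_space[OF assms(1)] and ne = sample_space_nonempty
  define U where "U = E \<times> {..<n}"
  have U: "finite U" "card U = n * card E" using assms by (auto simp: U_def)
  have ub: "ent (sample_space E n) (res S') \<le> card S'" if "S' \<subseteq> U" for S'
  proof -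
    have S': "finite S'" using that U finite_subset by auto
    have "res S' ` sample_space E n \<subseteq> (\<lambda>T x. x \<in> T) ` Pow S'"
    proof
      fix y assume "y \<in> res S' ` sample_space E n"
      then show "y \<in> (\<lambda>T x. x \<in> T) ` Pow S'"
        by (intro image_eqI[of _ _ "Collect y"]) (auto simp: res_def)
    qed
    then have "ent (sample_space E n) (res S') \<le> log 2 (card ((\<lambda>T x. x \<in> T) ` Pow S'))"
      using S' by (intro ent_le_log_card[OF fin ne]) auto
    also have "card ((\<lambda>T x. x \<in> T) ` Pow S') = 2 ^ card S'"
      using S' by (subst card_image) (auto simp: inj_on_def fun_eq_iff card_Pow)
    finally show ?thesis by (simp add: log_nat_power)
  qed
  have "ent (sample_space E n) (\<lambda>xi. xi) = card U"
    by (simp add: ent_id[OF fin ne] card_sample_space assms(1) U log_nat_power)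
  moreover have "ent (sample_space E n) (\<lambda>xi. xi) \<le> ent (sample_space E n) (\<lambda>xi. (res S xi, res (U - S) xi))"
    by (rule ent_mono[OF fin]) (auto simp: res_eq_iff U_def intro: sample_ext)
  moreover have "\<dots> \<le> ent (sample_space E n) (res S) + ent (sample_space E n) (res (U - S))"
    using ent_subadditive[OF fin ne] by fastforce
  moreover have "card (U - S) + card S = card U"
    using assms(2) U finite_subset[of S U] card_Diff_subset[of S U] card_mono[of U S]
    by (auto simp: U_def)
  ultimately show ?thesis
    using ub[of S] ub[of "U - S"] assms(2) unfolding U_def[symmetric] by simp
qed

locale pin_graph =
  fixes m :: nat and E :: "'e set" and ends :: "'e \<Rightarrow> nat set"
  assumes m_ge_2: "m \<ge> 2"
    and finite_E: "finite E"
    and ends_subset: "e \<in> E \<Longrightarrow> ends e \<subseteq> terminals m"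
    and card_ends: "e \<in> E \<Longrightarrow> card (ends e) = 2"
begin

abbreviation touching :: "nat set \<Rightarrow> 'e set" where
  "touching A \<equiv> {e \<in> E. ends e \<inter> A \<noteq> {}}"

text \<open>Edges between different cells, the cells being the colour classes of \<open>c\<close>:
  an edge crosses if its two ends get different colours.\<close>

abbreviation crossing :: "(nat \<Rightarrow> nat) \<Rightarrow> 'e set" where
  "crossing c \<equiv> {e \<in> E. card (c ` ends e) = 2}"

lemma finite_terminals [simp]: "finite (terminals m)"
  and card_terminals [simp]: "card (terminals m) = m"
  by (simp_all add: terminals_def)

lemmas finite_sample = finite_sample_space[OF finite_E]

lemma finite_ends: "e \<in> E \<Longrightarrow> finite (ends e)"
  using card_ends by (metis card.infinite zero_neq_numeral)

lemma ends_meet: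
  assumes "e \<in> E"
  obtains v where "v \<in> ends e" "v \<in> terminals m"
proof -
  have "ends e \<noteq> {}" using card_ends[OF assms] by auto
  then show ?thesis using that ends_subset[OF assms] by auto
qed

lemma copies_eq: "copies E ends n A = touching A \<times> {..<n}"
  by (auto simp: copies_def)

lemma ent_obs: "ent (sample_space E n) (obs E ends n A) = n * card (touching A)"
  unfolding obs_eq_res by (subst ent_res[OF finite_E]) (auto simp: copies_eq card_cartesian_product)

lemma ent_sample: "ent (sample_space E n) (\<lambda>xi. xi) = n * card E"
  by (simp add: ent_id[OF finite_sample sample_space_nonempty] card_sample_space finite_E log_nat_power)

lemma touching_terminals: "touching (terminals m) = E"
  using ends_meet by blast

lemma H_X_eq: "H_X E ends A = card (touching A)"
  by (simp add: H_X_def ent_obs)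

text \<open>\<open>B\<close> and its complement together see every edge. The difference on the right
  is the number of edges inside \<open>B\<close>.\<close>

lemma H_cond_eq:
  assumes "B \<subseteq> terminals m"
  shows "H_cond E ends B (terminals m - B) = real (card E) - card (touching (terminals m - B))"
proof -
  have "ent (sample_space E 1) (\<lambda>xi. (obs E ends 1 B xi, obs E ends 1 (terminals m - B) xi))
      = ent (sample_space E 1) (\<lambda>xi. xi)"
  proof (intro ent_cong[OF finite_sample] iffI)
    fix xi xi' assume *: "xi \<in> sample_space E 1" "xi' \<in> sample_space E 1"
      and eq: "(obs E ends 1 B xi, obs E ends 1 (terminals m - B) xi) =
        (obs E ends 1 B xi', obs E ends 1 (terminals m - B) xi')"
    show "xi = xi'"
    proof (rule sample_ext[OF *])
      fix x assume x: "x \<in> E \<times> {..<1::nat}"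
      have "ends (fst x) \<inter> B \<noteq> {} \<or> ends (fst x) \<inter> (terminals m - B) \<noteq> {}"
        using x ends_meet[of "fst x"] by (metis Diff_iff IntI SigmaE empty_iff fst_conv)
      then have "x \<in> copies E ends 1 B \<or> x \<in> copies E ends 1 (terminals m - B)"
        using x by (auto simp: copies_def)
      then show "xi x = xi' x"
        using eq by (auto simp: obs_eq_res res_eq_iff)
    qed
  qed auto
  then show ?thesis
    by (simp add: H_cond_def cond_ent_def ent_sample ent_obs)
qed

section \<open>Multipartite information as a minimum over colourings\<close>

lemma finite_partition:
  assumes "partition_on (terminals m) P"
  shows "finite P"
  using assms finite_terminals by (rule finite_elements[rotated])

lemma finite_Deltas:
  "finite {Delta E ends m P | P. partition_on (terminals m) P \<and> card P \<ge> 2}"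
proof -
  have "finite {P. partition_on (terminals m) P \<and> card P \<ge> 2}"
    by (rule finite_subset[of _ "Pow (Pow (terminals m))"]) (auto simp: partition_on_def)
  then show ?thesis by simp
qed

lemma MI_le:
  assumes "partition_on (terminals m) P" "card P \<ge> 2"
  shows "MI E ends m \<le> Delta E ends m P"
  unfolding MI_def using assms by (intro Min_le finite_Deltas) blast

lemma partition_on_singletons: "partition_on (terminals m) (singleton_partition m)"
  by (auto simp: partition_on_def singleton_partition_def disjoint_def)

lemma card_singleton_partition: "card (singleton_partition m) = m"
  unfolding singleton_partition_def by (subst card_image) (auto simp: inj_on_def)

lemma MI_attained:
  obtains P where "partition_on (terminals m) P" "card P \<ge> 2" "MI E ends m = Delta E ends m P"
proof -
  have "MI E ends m \<in> {Delta E ends m P | P. partition_on (terminals m) P \<and> card P \<ge> 2}"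
    unfolding MI_def
    by (intro Min_in finite_Deltas)
       (use partition_on_singletons card_singleton_partition m_ge_2 in auto)
  then show ?thesis using that by blast
qed

lemma MI_nonneg: "0 \<le> MI E ends m"
proof -
  obtain P where P: "partition_on (terminals m) P" "card P \<ge> 2" "MI E ends m = Delta E ends m P"
    by (rule MI_attained)
  have "E \<subseteq> (\<Union>A\<in>P. touching A)"
  proof
    fix e assume "e \<in> E"
    moreover then obtain v where "v \<in> ends e" "v \<in> \<Union>P"
      using ends_meet P(1) by (metis partition_on_def)
    ultimately show "e \<in> (\<Union>A\<in>P. touching A)" by blast
  qed
  then have "card E \<le> card (\<Union>A\<in>P. touching A)"
    using finite_E by (intro card_mono) (auto simp: finite_partition[OF P(1)])
  also have "\<dots> \<le> (\<Sum>A\<in>P. card (touching A))"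
    by (rule card_UN_le[OF finite_partition[OF P(1)]])
  finally have "real (card E) \<le> (\<Sum>A\<in>P. real (card (touching A)))"
    by (simp flip: of_nat_sum)
  then show ?thesis
    using P(2,3) by (simp add: Delta_def H_X_eq touching_terminals)
qed

text \<open>Double counting: an edge touches as many cells as its ends have colours, that is, one,
  and one more if it crosses. Subtracting \<open>card E\<close> leaves the crossing edges.\<close>

lemma Delta_coloring:
  fixes c :: "nat \<Rightarrow> nat"
  defines "P \<equiv> (\<lambda>l. {v \<in> terminals m. c v = l}) ` c ` terminals m"
  shows "partition_on (terminals m) P" "card P = card (c ` terminals m)"
    "Delta E ends m P = card (crossing c) / (real (card (c ` terminals m)) - 1)"
proof -
  show "partition_on (terminals m) P"
    by (auto simp: P_def partition_on_def disjoint_def)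
  have inj: "inj_on (\<lambda>l. {v \<in> terminals m. c v = l}) (c ` terminals m)"
    by (auto simp: inj_on_def set_eq_iff)
  then show card: "card P = card (c ` terminals m)"
    unfolding P_def by (rule card_image)
  have "(\<Sum>A\<in>P. card (touching A)) = (\<Sum>l\<in>c ` terminals m. card (touching {v \<in> terminals m. c v = l}))"
    unfolding P_def using inj by (simp add: sum.reindex)
  also have "\<dots> = (\<Sum>l\<in>c ` terminals m. \<Sum>e\<in>E. if l \<in> c ` ends e then 1 else 0)"
  proof (intro sum.cong refl)
    fix l assume "l \<in> c ` terminals m"
    have "touching {v \<in> terminals m. c v = l} = {e \<in> E. l \<in> c ` ends e}"
      using ends_subset by blast
    then show "card (touching {v \<in> terminals m. c v = l}) = (\<Sum>e\<in>E. if l \<in> c ` ends e then 1 else 0)"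
      using finite_E by (simp add: sum.If_cases Int_def)
  qed
  also have "\<dots> = (\<Sum>e\<in>E. \<Sum>l\<in>c ` terminals m. if l \<in> c ` ends e then 1 else 0)"
    by (rule sum.swap)
  also have "\<dots> = (\<Sum>e\<in>E. 1 + (if card (c ` ends e) = 2 then 1 else 0))"
  proof (intro sum.cong refl)
    fix e assume e: "e \<in> E"
    have "c ` terminals m \<inter> {l. l \<in> c ` ends e} = c ` ends e"
      using ends_subset[OF e] by auto
    moreover have "card (c ` ends e) \<le> 2" "card (c ` ends e) > 0"
      using card_image_le[OF finite_ends[OF e], of c] card_ends[OF e] finite_ends[OF e]
      by (auto simp: card_gt_0_iff)
    ultimately show "(\<Sum>l\<in>c ` terminals m. if l \<in> c ` ends e then 1 else 0) =
        1 + (if card (c ` ends e) = 2 then 1 else (0::nat))"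
      by (simp add: sum.If_cases)
  qed
  also have "\<dots> = card E + card (crossing c)"
    using finite_E by (simp add: sum_Suc sum.If_cases Int_def)
  finally have "real (\<Sum>A\<in>P. card (touching A)) = real (card E + card (crossing c))"
    by (rule arg_cong)
  then have "(\<Sum>A\<in>P. real (card (touching A))) = card E + card (crossing c)"
    by simp
  then show "Delta E ends m P = card (crossing c) / (real (card (c ` terminals m)) - 1)"
    by (simp add: Delta_def H_X_eq touching_terminals card)
qed

text \<open>Clearing the denominator extends the bound to a single colour, where the left side is
  not positive. In this form it is the cut condition for finding light trees.\<close>

lemma MI_le_crossing:
  "MI E ends m * (real (card (c ` terminals m)) - 1) \<le> card (crossing c)"
proof (cases "card (c ` terminals m) \<ge> 2")
  case True
  then show ?thesis
    using MI_le[OF Delta_coloring(1), of c] Delta_coloring(2,3)[of c]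
    by (simp add: field_simps)
next
  case False
  then have "real (card (c ` terminals m)) - 1 \<le> 0" by simp
  then have "MI E ends m * (real (card (c ` terminals m)) - 1) \<le> 0"
    using MI_nonneg by (intro mult_nonneg_nonpos)
  also have "0 \<le> real (card (crossing c))" by simp
  finally show ?thesis .
qed

lemma Delta_singletons: "Delta E ends m (singleton_partition m) = card E / (real m - 1)"
proof -
  have "(\<lambda>l. {v \<in> terminals m. id v = l}) ` id ` terminals m = singleton_partition m"
    by (auto simp: singleton_partition_def)
  moreover have "crossing id = E" using card_ends by auto
  ultimately show ?thesis using Delta_coloring(3)[of id] by simp
qed

lemma type_S_iff: "type_S E ends m \<longleftrightarrow> MI E ends m * (real m - 1) = card E"
  using m_ge_2 by (auto simp: type_S_def Delta_singletons field_simps)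

lemma MI_times_le: "MI E ends m * (real m - 1) \<le> card E"
  using MI_le[OF partition_on_singletons] m_ge_2
  by (simp add: Delta_singletons card_singleton_partition field_simps)

section \<open>Communication for omniscience\<close>

definition CO_rates :: "(nat \<Rightarrow> real) set" where
  "CO_rates = {R. \<forall>B. B \<noteq> {} \<and> B \<subset> terminals m \<longrightarrow>
     (\<Sum>i\<in>B. R i) \<ge> H_cond E ends B (terminals m - B)}"

lemma R_CO_eq: "R_CO E ends m = Inf ((\<lambda>R. \<Sum>i\<in>terminals m. R i) ` CO_rates)"
  unfolding R_CO_def CO_rates_def by (rule arg_cong[where f = Inf]) auto

text \<open>Add the constraints for the complements of the cells of an optimal partition
  \<open>P\<close>: every terminal lies in \<open>card P - 1\<close> of these complements.\<close>

lemma CO_rates_sum_ge: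
  assumes "R \<in> CO_rates"
  shows "card E - MI E ends m \<le> (\<Sum>i\<in>terminals m. R i)"
proof -
  obtain P where P: "partition_on (terminals m) P" "card P \<ge> 2" "MI E ends m = Delta E ends m P"
    by (rule MI_attained)
  let ?S = "\<Sum>i\<in>terminals m. R i"
  have fin: "finite P" by (rule finite_partition[OF P(1)])
  have fA: "A \<subseteq> terminals m" "finite A" "A \<noteq> {}" if "A \<in> P" for A
    using that P(1) finite_subset[OF _ finite_terminals] by (auto simp: partition_on_def)
  have "real (card E) - card (touching A) \<le> ?S - (\<Sum>i\<in>A. R i)" if A: "A \<in> P" for A
  proof -
    have "A \<noteq> terminals m"
    proof
      assume "A = terminals m"
      then have "P = {A}"
        using P(1) A fA by (auto simp: partition_on_def disjoint_def) blast+
      then show False using P(2) by simp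
    qed
    then have "terminals m - A \<noteq> {}" "terminals m - A \<subset> terminals m"
      using fA[OF A] by auto
    then have "H_cond E ends (terminals m - A) (terminals m - (terminals m - A)) \<le> (\<Sum>i\<in>terminals m - A. R i)"
      using assms by (simp add: CO_rates_def)
    moreover have "terminals m - (terminals m - A) = A" using fA[OF A] by auto
    moreover have "(\<Sum>i\<in>terminals m - A. R i) = ?S - (\<Sum>i\<in>A. R i)"
      using fA[OF A] by (intro sum_diff) auto
    ultimately show ?thesis
      using H_cond_eq[of "terminals m - A"] by simp
  qed
  then have "(\<Sum>A\<in>P. real (card E) - card (touching A)) \<le> (\<Sum>A\<in>P. ?S - (\<Sum>i\<in>A. R i))"
    by (rule sum_mono)
  moreover have "(\<Sum>A\<in>P. \<Sum>i\<in>A. R i) = ?S"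
    using sum.Union_disjoint[of P R] P(1) fA by (auto simp: partition_on_def disjoint_def)
  ultimately have "(real (card P) - 1) * real (card E) - ((\<Sum>A\<in>P. real (card (touching A))) - card E)
      \<le> (real (card P) - 1) * ?S"
    by (simp add: sum_subtractf algebra_simps)
  then have "card E - ((\<Sum>A\<in>P. real (card (touching A))) - card E) / (real (card P) - 1) \<le> ?S"
    using P(2) by (simp add: field_simps)
  then show ?thesis
    using P(3) by (simp add: Delta_def H_X_eq touching_terminals)
qed

lemma CO_rates_nonempty: "CO_rates \<noteq> {}"
proof -
  have "(\<lambda>_. real (card E)) \<in> CO_rates"
  proof -
    have "H_cond E ends B (terminals m - B) \<le> (\<Sum>i\<in>B. real (card E))"
      if B: "B \<noteq> {}" "B \<subset> terminals m" for B
    proof -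
      have "finite B" by (rule finite_subset[OF _ finite_terminals]) (use B in auto)
      then have "card B \<ge> 1" using B by (simp add: Suc_le_eq card_gt_0_iff)
      then have "1 * real (card E) \<le> real (card B) * card E"
        by (intro mult_right_mono) auto
      then show ?thesis using B by (subst H_cond_eq) auto
    qed
    then show ?thesis by (auto simp: CO_rates_def)
  qed
  then show ?thesis by auto
qed

lemma R_CO_ge: "card E - MI E ends m \<le> R_CO E ends m"
  unfolding R_CO_eq using CO_rates_nonempty CO_rates_sum_ge by (intro cInf_greatest) auto

lemma sum_degree: "(\<Sum>i\<in>terminals m. real (card (touching {i}))) = 2 * card E"
proof -
  have "(\<Sum>i\<in>terminals m. card (touching {i})) = (\<Sum>i\<in>terminals m. \<Sum>e\<in>E. if i \<in> ends e then 1 else 0)"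
    using finite_E by (intro sum.cong) (auto simp: sum.If_cases Int_def)
  also have "\<dots> = (\<Sum>e\<in>E. \<Sum>i\<in>terminals m. if i \<in> ends e then 1 else 0)"
    by (rule sum.swap)
  also have "\<dots> = (\<Sum>e\<in>E. 2)"
  proof (intro sum.cong refl)
    fix e assume e: "e \<in> E"
    have "terminals m \<inter> {i. i \<in> ends e} = ends e" using ends_subset[OF e] by auto
    then show "(\<Sum>i\<in>terminals m. if i \<in> ends e then 1 else 0) = (2::nat)"
      using card_ends[OF e] by (simp add: sum.If_cases)
  qed
  finally have "(\<Sum>i\<in>terminals m. card (touching {i})) = 2 * card E" by simp
  then have "real (\<Sum>i\<in>terminals m. card (touching {i})) = real (2 * card E)"
    by (rule arg_cong)
  then show ?thesis by simp
qed

text \<open>Take the terminals of \<open>B\<close> as singleton classes and the nonempty rest as one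
  more class. This gives \<open>card B + 1\<close> classes, and every crossing edge meets
  \<open>B\<close>.\<close>

lemma MI_le_touching:
  assumes "B \<noteq> {}" "B \<subset> terminals m"
  shows "MI E ends m * card B \<le> card (touching B)"
proof -
  \<comment> \<open>The colour \<open>0\<close> is free for the rest, since terminals are numbered
    from 1.\<close>
  define c where "c v = (if v \<in> B then v else 0)" for v :: nat
  have fB: "finite B" by (rule finite_subset[OF _ finite_terminals]) (use assms in auto)
  have B0: "0 \<notin> B" using assms by (auto simp: terminals_def)
  have "c ` terminals m = insert 0 B"
    using assms by (auto simp: c_def image_iff)
  then have card: "card (c ` terminals m) = card B + 1" using fB B0 by simp
  have "crossing c \<subseteq> touching B"
  proof
    fix e assume e: "e \<in> crossing c"
    have "ends e \<inter> B \<noteq> {}"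
    proof
      assume "ends e \<inter> B = {}"
      then have "c ` ends e \<subseteq> {0}" by (auto simp: c_def)
      then have "card (c ` ends e) \<le> 1" using card_mono[of "{0::nat}"] by fastforce
      then show False using e by simp
    qed
    then show "e \<in> touching B" using e by simp
  qed
  then have "card (crossing c) \<le> card (touching B)"
    using finite_E by (intro card_mono) auto
  then show ?thesis using MI_le_crossing[of c] card by simp
qed

text \<open>The degrees in \<open>B\<close> add up to the edges touching \<open>B\<close> plus those
  inside \<open>B\<close>, and the latter are the required rate. What remains of each constraint is
  \<open>MI_le_touching\<close>. The total \<open>2 * card E - m * I\<close> equals
  \<open>card E - I\<close> exactly because of Type S.\<close>

lemma R_CO_type_S_le:
  assumes "type_S E ends m"
  shows "R_CO E ends m \<le> card E - MI E ends m"
proof -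
  define R where "R i = real (card (touching {i})) - MI E ends m" for i
  have "R \<in> CO_rates"
    unfolding CO_rates_def mem_Collect_eq
  proof (intro allI impI)
    fix B assume B: "B \<noteq> {} \<and> B \<subset> terminals m"
    have fB: "finite B" by (rule finite_subset[OF _ finite_terminals]) (use B in auto)
    have deg: "(\<Sum>i\<in>B. card (touching {i})) = (\<Sum>e\<in>E. card (ends e \<inter> B))"
    proof -
      have "(\<Sum>i\<in>B. card (touching {i})) = (\<Sum>i\<in>B. \<Sum>e\<in>E. if i \<in> ends e then 1 else 0)"
        using finite_E by (intro sum.cong) (auto simp: sum.If_cases Int_def)
      also have "\<dots> = (\<Sum>e\<in>E. \<Sum>i\<in>B. if i \<in> ends e then 1 else 0)"
        by (rule sum.swap)
      finally show ?thesis using fB by (simp add: sum.If_cases Int_commute)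
    qed
    \<comment> \<open>Edge by edge: both sides count 2 for an edge meeting \<open>B\<close>, whether
      inside it or leaving it, and 1 for an edge avoiding \<open>B\<close>.\<close>
    have "card E + card (touching B) \<le> (\<Sum>e\<in>E. card (ends e \<inter> B)) + card (touching (terminals m - B))"
    proof -
      have "card (touching A) = (\<Sum>e\<in>E. if ends e \<inter> A \<noteq> {} then 1 else 0)" for A
        using finite_E by (simp add: sum.If_cases Int_def)
      moreover have "(\<Sum>e\<in>E. 1 + (if ends e \<inter> B \<noteq> {} then 1 else 0)) \<le>
          (\<Sum>e\<in>E. card (ends e \<inter> B) + (if ends e \<inter> (terminals m - B) \<noteq> {} then 1 else 0))"
      proof (rule sum_mono)
        fix e assume e: "e \<in> E"
        show "1 + (if ends e \<inter> B \<noteq> {} then 1 else 0) \<le>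
          card (ends e \<inter> B) + (if ends e \<inter> (terminals m - B) \<noteq> {} then 1 else (0::nat))"
        proof (cases "ends e \<inter> (terminals m - B) \<noteq> {}")
          case True
          moreover have "card (ends e \<inter> B) > 0" if "ends e \<inter> B \<noteq> {}"
            using that fB by (simp add: card_gt_0_iff)
          ultimately show ?thesis
            by (cases "ends e \<inter> B = {}") (simp_all add: Suc_le_eq)
        next
          case False
          then have "ends e \<inter> B = ends e" using ends_subset[OF e] by auto
          then show ?thesis using card_ends[OF e] by simp
        qed
      qed
      ultimately show ?thesis by (simp add: sum.distrib sum_Suc)
    qed
    then have "card E + real (card (touching B)) \<le> (\<Sum>i\<in>B. real (card (touching {i}))) + card (touching (terminals m - B))"
      unfolding deg[symmetric] by (simp flip: of_nat_sum of_nat_add)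
    then show "H_cond E ends B (terminals m - B) \<le> (\<Sum>i\<in>B. R i)"
      using MI_le_touching[of B] B H_cond_eq[OF psubset_imp_subset, of B]
      by (simp add: R_def sum_subtractf mult.commute)
  qed
  moreover have "(\<Sum>i\<in>terminals m. R i) = card E - MI E ends m"
    unfolding R_def sum_subtractf sum_degree using assms by (simp add: type_S_iff algebra_simps)
  moreover have "bdd_below ((\<lambda>R. \<Sum>i\<in>terminals m. R i) ` CO_rates)"
    using CO_rates_sum_ge by (intro bdd_belowI2)
  ultimately show ?thesis
    unfolding R_CO_eq by (metis cInf_lower imageI)
qed

end

section \<open>Converse\<close>

lemma run_append: "run E ends n (ts @ ts') xi acc = run E ends n ts' xi (run E ends n ts xi acc)"
  by (induction ts arbitrary: acc) auto

lemma transcript_snoc: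
  "transcript E ends n (F @ [t]) xi =
   transcript E ends n F xi @ [snd t (obs E ends n {fst t} xi) (transcript E ends n F xi)]"
  by (simp add: transcript_def run_append)

context pin_graph
begin

text \<open>Equivalently \<open>H(F) \<le> (\<Sum>i. I(F; X\<^sub>i))\<close>: by the chain rule, every transmission adds to
  the mutual information with its own sender at least its conditional entropy.\<close>

lemma ent_transcript_le:
  assumes "valid_protocol m F"
  shows "ent (sample_space E n) (transcript E ends n F) \<le>
    (\<Sum>i\<in>terminals m. ent (sample_space E n) (transcript E ends n F) +
      ent (sample_space E n) (obs E ends n {i}) -
      ent (sample_space E n) (\<lambda>xi. (obs E ends n {i} xi, transcript E ends n F xi)))"
  using assms
proof (induction F rule: rev_induct)
  case Nil
  have "ent (sample_space E n) (\<lambda>xi. (obs E ends n {i} xi, [] :: nat list)) =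
      ent (sample_space E n) (obs E ends n {i})" for i
    by (rule ent_cong[OF finite_sample]) auto
  then show ?case
    by (simp add: transcript_def ent_const[OF finite_sample sample_space_nonempty])
next
  case (snoc t F)
  let ?H = "\<lambda>f. ent (sample_space E n) f"
  define G where "G = transcript E ends n F"
  define G' where "G' = transcript E ends n (F @ [t])"
  define X where "X i = obs E ends n {i}" for i
  define msg where "msg xi = snd t (X (fst t) xi) (G xi)" for xi
  have G': "G' = (\<lambda>xi. G xi @ [msg xi])"
    by (simp add: G'_def G_def msg_def X_def transcript_snoc fun_eq_iff)
  have t: "fst t \<in> terminals m" and F: "valid_protocol m F"
    using snoc.prems by (auto simp: valid_protocol_def)
  have "?H G + (?H G' - ?H G) \<le>
      (\<Sum>i\<in>terminals m. ?H G + ?H (X i) - ?H (\<lambda>xi. (X i xi, G xi))) +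
      (\<Sum>i\<in>terminals m. if i = fst t then ?H G' - ?H G else 0)"
    using snoc.IH[OF F] t by (simp add: G_def X_def)
  also have "\<dots> = (\<Sum>i\<in>terminals m. ?H G + ?H (X i) - ?H (\<lambda>xi. (X i xi, G xi)) +
      (if i = fst t then ?H G' - ?H G else 0))"
    by (simp only: sum.distrib)
  also have "\<dots> \<le> (\<Sum>i\<in>terminals m. ?H G' + ?H (X i) - ?H (\<lambda>xi. (X i xi, G' xi)))"
  proof (rule sum_mono)
    fix i
    show "?H G + ?H (X i) - ?H (\<lambda>xi. (X i xi, G xi)) + (if i = fst t then ?H G' - ?H G else 0)
      \<le> ?H G' + ?H (X i) - ?H (\<lambda>xi. (X i xi, G' xi))"
    proof (cases "i = fst t")
      case True
      have "?H (\<lambda>xi. (X i xi, G' xi)) = ?H (\<lambda>xi. (X i xi, G xi))"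
        using True by (intro ent_cong[OF finite_sample]) (auto simp: G' msg_def)
      then show ?thesis using True by simp
    next
      case False
      \<comment> \<open>For a terminal that is not the sender, information about the transcript
        cannot drop: conditioning on \<open>X i\<close> does not increase the entropy of
        \<open>msg\<close> given \<open>G\<close>.\<close>
      have "?H (\<lambda>xi. (msg xi, X i xi, G xi)) + ?H G \<le> ?H (\<lambda>xi. (msg xi, G xi)) + ?H (\<lambda>xi. (X i xi, G xi))"
        by (rule ent_submodular[OF finite_sample sample_space_nonempty])
      moreover have "?H (\<lambda>xi. (msg xi, X i xi, G xi)) = ?H (\<lambda>xi. (X i xi, G' xi))"
        by (rule ent_cong[OF finite_sample]) (auto simp: G')
      moreover have "?H (\<lambda>xi. (msg xi, G xi)) = ?H G'"
        by (rule ent_cong[OF finite_sample]) (auto simp: G')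
      ultimately show ?thesis using False by simp
    qed
  qed
  finally show ?case by (simp add: G'_def X_def)
qed

text \<open>A conditional Shearer inequality: every edge bit is seen by exactly two terminals.\<close>

lemma sum_cond_ent_obs_ge:
  assumes "S \<subseteq> E \<times> {..<n}"
  shows "2 * (ent (sample_space E n) (\<lambda>xi. (res S xi, L xi)) - ent (sample_space E n) L) \<le>
    (\<Sum>i\<in>terminals m. ent (sample_space E n) (\<lambda>xi. (res (S \<inter> copies E ends n {i}) xi, L xi)) -
       ent (sample_space E n) L)"
proof -
  have "finite S" using assms finite_E finite_subset by blast
  then show ?thesis using assms
  proof (induction S)
    case empty
    have "ent (sample_space E n) (\<lambda>xi. (res {} xi, L xi)) = ent (sample_space E n) L"
      by (rule ent_cong[OF finite_sample]) (auto simp: res_def)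
    then show ?case by simp
  next
    case (insert x S)
    let ?H = "\<lambda>f. ent (sample_space E n) f"
    let ?C = "\<lambda>i. copies E ends n {i}"
    let ?d = "?H (\<lambda>xi. (res (insert x S) xi, L xi)) - ?H (\<lambda>xi. (res S xi, L xi))"
    obtain e k where x: "x = (e, k)" "e \<in> E" "k < n" using insert.prems by auto
    have xC: "x \<in> ?C i \<longleftrightarrow> i \<in> ends e" for i
      using x by (auto simp: copies_def)
    have "terminals m \<inter> {i. i \<in> ends e} = ends e" using ends_subset[OF x(2)] by auto
    then have "2 * ?d = (\<Sum>i\<in>terminals m. if i \<in> ends e then ?d else 0)"
      using card_ends[OF x(2)] by (simp add: sum.If_cases)
    then have "2 * (?H (\<lambda>xi. (res (insert x S) xi, L xi)) - ?H L) =
        2 * (?H (\<lambda>xi. (res S xi, L xi)) - ?H L) + (\<Sum>i\<in>terminals m. if i \<in> ends e then ?d else 0)"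
      by simp
    also have "\<dots> \<le> (\<Sum>i\<in>terminals m. ?H (\<lambda>xi. (res (S \<inter> ?C i) xi, L xi)) - ?H L) +
        (\<Sum>i\<in>terminals m. if i \<in> ends e then ?d else 0)"
      using insert by simp
    also have "\<dots> = (\<Sum>i\<in>terminals m. ?H (\<lambda>xi. (res (S \<inter> ?C i) xi, L xi)) - ?H L +
        (if i \<in> ends e then ?d else 0))"
      by (simp only: sum.distrib)
    also have "\<dots> \<le> (\<Sum>i\<in>terminals m. ?H (\<lambda>xi. (res (insert x S \<inter> ?C i) xi, L xi)) - ?H L)"
    proof (rule sum_mono)
      fix i
      show "?H (\<lambda>xi. (res (S \<inter> ?C i) xi, L xi)) - ?H L + (if i \<in> ends e then ?d else 0)
        \<le> ?H (\<lambda>xi. (res (insert x S \<inter> ?C i) xi, L xi)) - ?H L"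
      proof (cases "i \<in> ends e")
        case True
        \<comment> \<open>Terminal \<open>i\<close> conditions on fewer bits than all of
          \<open>S\<close>, so for it the new bit \<open>x\<close> adds at least \<open>?d\<close>.
          The two ends of the edge together pay for \<open>2 * ?d\<close>.\<close>
        have "?H (\<lambda>xi. (xi x, res S xi, res (S \<inter> ?C i) xi, L xi)) + ?H (\<lambda>xi. (res (S \<inter> ?C i) xi, L xi))
          \<le> ?H (\<lambda>xi. (xi x, res (S \<inter> ?C i) xi, L xi)) + ?H (\<lambda>xi. (res S xi, res (S \<inter> ?C i) xi, L xi))"
          by (rule ent_submodular[OF finite_sample sample_space_nonempty])
        moreover have "?H (\<lambda>xi. (xi x, res S xi, res (S \<inter> ?C i) xi, L xi)) =
            ?H (\<lambda>xi. (res (insert x S) xi, L xi))"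
          by (rule ent_cong[OF finite_sample]) (auto simp: res_eq_iff)
        moreover have "?H (\<lambda>xi. (xi x, res (S \<inter> ?C i) xi, L xi)) =
            ?H (\<lambda>xi. (res (insert x S \<inter> ?C i) xi, L xi))"
          using True by (intro ent_cong[OF finite_sample]) (auto simp: res_eq_iff xC)
        moreover have "?H (\<lambda>xi. (res S xi, res (S \<inter> ?C i) xi, L xi)) = ?H (\<lambda>xi. (res S xi, L xi))"
          by (rule ent_cong[OF finite_sample]) (auto simp: res_eq_iff)
        ultimately show ?thesis using True by simp
      next
        case False
        then show ?thesis by (simp add: xC)
      qed
    qed
    finally show ?case .
  qed
qed

text \<open>By Fano, replacing \<open>T\<close> by \<open>L = (K, T)\<close> next to
  \<open>X i\<close> costs at most \<open>\<phi>\<close> for each of the \<open>m\<close> terminals.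
  The edge inequality bounds \<open>2 * (n * card E - H L)\<close>, and the bound on interactive
  transcripts limits the sum of the \<open>H (X i, T)\<close> by
  \<open>2 * n * card E + (m - 1) * H T\<close>. The edge terms cancel and the claim is
  left.\<close>

lemma ent_transcript_ge:
  fixes K :: "'e sample \<Rightarrow> nat" and \<epsilon> :: real
  assumes F: "valid_protocol m F"
    and J: "unif_prob (sample_space E n)
      (\<lambda>xi. \<forall>i\<in>terminals m. J i (obs E ends n {i} xi) (transcript E ends n F xi) = K xi) \<ge> 1 - \<epsilon>"
  shows "(real m - 2) * (ent (sample_space E n) (\<lambda>xi. (K xi, transcript E ends n F xi)) -
      ent (sample_space E n) (transcript E ends n F))
    \<le> ent (sample_space E n) (transcript E ends n F) + m * (1 + \<epsilon> * (n * card E))"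
proof -
  let ?H = "\<lambda>f. ent (sample_space E n) f"
  define T where "T = transcript E ends n F"
  define L where "L = (\<lambda>xi. (K xi, T xi))"
  define X where "X i = obs E ends n {i}" for i
  define \<phi> where "\<phi> = 1 + \<epsilon> * (n * card E)"
  have log: "log 2 (card (sample_space E n)) = n * card E"
    by (simp add: card_sample_space finite_E log_nat_power)
  have fano: "?H (\<lambda>xi. (X i xi, L xi)) \<le> ?H (\<lambda>xi. (X i xi, T xi)) + \<phi>" if i: "i \<in> terminals m" for i
  proof -
    have "1 - \<epsilon> \<le> unif_prob (sample_space E n) (\<lambda>xi. \<forall>i\<in>terminals m. J i (X i xi) (T xi) = K xi)"
      using J by (simp add: X_def T_def)
    also have "\<dots> \<le> unif_prob (sample_space E n) (\<lambda>xi. J i (X i xi) (T xi) = K xi)"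
      using i by (intro unif_prob_mono finite_sample) auto
    finally have "?H (\<lambda>xi. (K xi, X i xi, T xi)) \<le> ?H (\<lambda>xi. (X i xi, T xi)) + 1 + \<epsilon> * (n * card E)"
      unfolding log[symmetric]
      by (intro fano[OF finite_sample sample_space_nonempty, where J = "\<lambda>p. J i (fst p) (snd p)"]) simp
    moreover have "?H (\<lambda>xi. (K xi, X i xi, T xi)) = ?H (\<lambda>xi. (X i xi, L xi))"
      by (rule ent_cong[OF finite_sample]) (auto simp: L_def)
    ultimately show ?thesis by (simp add: \<phi>_def)
  qed
  have sum_X: "(\<Sum>i\<in>terminals m. ?H (X i)) = 2 * (n * card E)"
    using sum_degree by (simp add: X_def ent_obs flip: sum_distrib_left)
  have res_copies: "(\<lambda>xi. (res ((E \<times> {..<n}) \<inter> copies E ends n {i}) xi, L xi)) = (\<lambda>xi. (X i xi, L xi))" for i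
  proof -
    have "(E \<times> {..<n}) \<inter> copies E ends n {i} = copies E ends n {i}" by (auto simp: copies_def)
    then show ?thesis by (simp add: X_def obs_eq_res)
  qed
  have "?H (\<lambda>xi. (res (E \<times> {..<n}) xi, L xi)) = ?H (\<lambda>xi. xi)"
    by (rule ent_cong[OF finite_sample]) (auto simp: res_eq_iff intro: sample_ext)
  then have "2 * (n * card E - ?H L) \<le> (\<Sum>i\<in>terminals m. ?H (\<lambda>xi. (X i xi, L xi)) - ?H L)"
    using sum_cond_ent_obs_ge[of "E \<times> {..<n}" n L] by (simp add: res_copies ent_sample)
  also have "\<dots> \<le> (\<Sum>i\<in>terminals m. ?H (\<lambda>xi. (X i xi, T xi)) + \<phi> - ?H L)"
    using fano by (intro sum_mono) simp
  also have "\<dots> = (\<Sum>i\<in>terminals m. ?H (\<lambda>xi. (X i xi, T xi))) + m * \<phi> - m * ?H L"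
    by (simp add: sum.distrib sum_subtractf)
  also have "(\<Sum>i\<in>terminals m. ?H (\<lambda>xi. (X i xi, T xi))) \<le> 2 * (n * card E) + (real m - 1) * ?H T"
    using ent_transcript_le[OF F, of n] unfolding T_def[symmetric] X_def[symmetric]
    by (simp add: sum.distrib sum_subtractf sum_X algebra_simps)
  finally have "(real m - 2) * (?H L - ?H T) \<le> ?H T + m * \<phi>"
    by (simp add: algebra_simps)
  then show ?thesis by (simp add: L_def T_def \<phi>_def)
qed

lemma SK_achievable_ge:
  assumes "SK_achievable E ends m R"
  shows "(real m - 2) * MI E ends m \<le> R"
proof (rule ccontr)
  assume "\<not> (real m - 2) * MI E ends m \<le> R"
  define \<delta> where "\<delta> = (real m - 2) * MI E ends m - R"
  have \<delta>: "\<delta> > 0" using \<open>\<not> _\<close> by (simp add: \<delta>_def)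
  \<comment> \<open>\<open>c\<close> collects the coefficients of \<open>n * \<epsilon>\<close>: 1
    from the rate, \<open>2 * (m - 2)\<close> from key rate and leakage (using
    \<open>\<epsilon> \<le> n * \<epsilon>\<close>), and \<open>m * card E\<close> from Fano. With
    \<open>\<epsilon> = \<delta> / (2 * c)\<close>, half of \<open>n * \<delta>\<close> remains
    against the constant \<open>m\<close>.\<close>
  define c where "c = 1 + 2 * (real m - 2) + real m * card E"
  have c: "c > 0"
    using m_ge_2 by (auto simp: c_def intro!: add_pos_nonneg)
  define \<epsilon> where "\<epsilon> = \<delta> / (2 * c)"
  have \<epsilon>: "\<epsilon> > 0" using \<delta> c by (simp add: \<epsilon>_def)
  obtain Fs Js and Ks :: "nat \<Rightarrow> 'e sample \<Rightarrow> nat" where valid: "\<And>n. valid_protocol m (Fs n)"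
    and ev: "eventually (\<lambda>n.
          log 2 (real (card (transcript E ends n (Fs n) ` sample_space E n))) / real n \<le> R + \<epsilon>
        \<and> unif_prob (sample_space E n)
            (\<lambda>xi. \<forall>i\<in>terminals m.
               Js n i (obs E ends n {i} xi) (transcript E ends n (Fs n) xi) = Ks n xi) \<ge> 1 - \<epsilon>
        \<and> mut_info (sample_space E n) (Ks n) (transcript E ends n (Fs n)) \<le> \<epsilon>
        \<and> ent (sample_space E n) (Ks n) / real n \<ge> MI E ends m - \<epsilon>) sequentially"
    using assms \<epsilon> unfolding SK_achievable_def by blast
  have "eventually (\<lambda>n. real n > 2 * m / \<delta>) sequentially"
    using filterlim_real_sequentially by (simp add: filterlim_at_top_dense)
  with ev eventually_gt_at_top[of 0] have "eventually (\<lambda>n. False) sequentially"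
  proof eventually_elim
    case (elim n)
    let ?H = "\<lambda>f. ent (sample_space E n) f"
    let ?T = "transcript E ends n (Fs n)"
    have n: "real n \<ge> 1" using elim by simp
    have "?H ?T \<le> log 2 (card (?T ` sample_space E n))"
      using finite_sample by (intro ent_le_log_card sample_space_nonempty) auto
    also have "\<dots> \<le> n * (R + \<epsilon>)" using elim n by (simp add: field_simps)
    finally have HT: "?H ?T \<le> n * (R + \<epsilon>)" .
    have "?H (\<lambda>xi. (Ks n xi, ?T xi)) - ?H ?T = ?H (Ks n) - mut_info (sample_space E n) (Ks n) ?T"
      by (simp add: mut_info_def)
    also have "\<dots> \<ge> n * (MI E ends m - \<epsilon>) - \<epsilon>" using elim n by (simp add: field_simps)
    finally have "(real m - 2) * (n * (MI E ends m - \<epsilon>) - \<epsilon>) \<le>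
        (real m - 2) * (?H (\<lambda>xi. (Ks n xi, ?T xi)) - ?H ?T)"
      using m_ge_2 by (intro mult_left_mono) auto
    also have "\<dots> \<le> ?H ?T + m * (1 + \<epsilon> * (n * card E))"
      using elim by (intro ent_transcript_ge valid) auto
    also have "\<dots> \<le> n * (R + \<epsilon>) + m * (1 + \<epsilon> * (n * card E))" using HT by simp
    finally have "n * \<delta> \<le> n * \<epsilon> + (real m - 2) * (n * \<epsilon> + \<epsilon>) + m + m * \<epsilon> * n * card E"
      by (simp add: \<delta>_def algebra_simps)
    also have "\<dots> \<le> n * \<epsilon> + (real m - 2) * (n * \<epsilon> + n * \<epsilon>) + m + m * \<epsilon> * n * card E"
      using m_ge_2 n \<epsilon> by (intro add_mono mult_left_mono) auto
    also have "\<dots> = n * (\<epsilon> * c) + m" by (simp add: c_def algebra_simps)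
    also have "\<epsilon> * c = \<delta> / 2" using c by (simp add: \<epsilon>_def)
    finally have "n * \<delta> \<le> 2 * m" by simp
    then show False using elim \<delta> by (simp add: field_simps)
  qed
  then show False by simp
qed

section \<open>Packing spanning trees\<close>

text \<open>\<open>T\<close> connects the graph obtained by contracting each colour class to a
  point, stated through cuts: \<open>B\<close> runs over the proper nonempty unions of classes. For
  \<open>c = id\<close> this is ordinary connectedness.\<close>

definition connects :: "(nat \<Rightarrow> nat) \<Rightarrow> 'e set \<Rightarrow> bool" where
  "connects c T \<longleftrightarrow> (\<forall>B. B \<noteq> {} \<and> B \<subset> terminals m \<and>
      (\<forall>v\<in>B. \<forall>w\<in>terminals m. c v = c w \<longrightarrow> w \<in> B) \<longrightarrow>
    (\<exists>e\<in>T. ends e \<inter> B \<noteq> {} \<and> \<not> ends e \<subseteq> B))"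

text \<open>Induction on the number of colours: by the cut condition, subtracting the least weight from all
  crossing edges lowers the right-hand side at least as much as the left-hand side; an edge of
  weight 0 then joins the tree for free, and its two colour classes are merged.\<close>

lemma light_connecting_set:
  fixes I :: real and a :: "'e \<Rightarrow> real"
  assumes I: "I > 0" and cut: "\<And>c. I * (real (card (c ` terminals m)) - 1) \<le> card (crossing c)"
    and "\<And>e. e \<in> crossing c \<Longrightarrow> 0 \<le> a e"
  shows "\<exists>T \<subseteq> crossing c. card T < card (c ` terminals m) \<and>
    I * (\<Sum>e\<in>T. a e) \<le> (\<Sum>e\<in>crossing c. a e) \<and> connects c T"
  using assms(3)
proof (induction "card (c ` terminals m)" arbitrary: c a rule: less_induct)
  case less
  have pos: "card (c ` terminals m) > 0"
    using m_ge_2 by (auto simp: card_gt_0_iff terminals_def)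
  have finc: "finite (crossing c')" for c' using finite_E by simp
  show ?case
  proof (cases "card (c ` terminals m) = 1")
    case True
    then obtain l where "c ` terminals m = {l}" by (auto simp: card_1_singleton_iff)
    then have "c v = c w" if "v \<in> terminals m" "w \<in> terminals m" for v w
      using that by (metis imageI singletonD)
    then have "connects c {}"
      unfolding connects_def by blast
    then show ?thesis
      using True less.prems by (intro exI[of _ "{}"]) (auto intro: sum_nonneg)
  next
    case False
    then have ge2: "card (c ` terminals m) \<ge> 2" using pos by simp
    \<comment> \<open>With at least two colours the cut condition and \<open>I > 0\<close> force a
      crossing edge, so a lightest one exists.\<close>
    then have "0 < I * (real (card (c ` terminals m)) - 1)" using I by simp
    also have "\<dots> \<le> card (crossing c)" by (rule cut)
    finally have "card (crossing c) \<noteq> 0" by simp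
    then have "crossing c \<noteq> {}" by (metis card.empty)
    then obtain e0 where e0: "e0 \<in> crossing c" "\<And>e. e \<in> crossing c \<Longrightarrow> a e0 \<le> a e"
      using finc[of c] by (metis (no_types, lifting) arg_min_if_finite(1) arg_min_least)
    define \<mu> where "\<mu> = a e0"
    define a' where "a' e = a e - \<mu>" for e
    obtain x y where xy: "ends e0 = {x, y}" "x \<noteq> y"
      using e0(1) card_ends[of e0] unfolding card_2_iff by blast
    have cxy: "c x \<noteq> c y" using e0(1) xy by auto
    have xyV: "x \<in> terminals m" "y \<in> terminals m" using e0(1) xy ends_subset[of e0] by auto
    define c' where "c' v = (if c v = c y then c x else c v)" for v
    have "c' ` terminals m = c ` terminals m - {c y}"
      using cxy xyV by (auto simp: c'_def)
    then have card': "card (c' ` terminals m) = card (c ` terminals m) - 1"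
      using xyV by simp
    have sub: "crossing c' \<subseteq> crossing c"
    proof
      fix e assume e: "e \<in> crossing c'"
      have "c' ` ends e = (\<lambda>l. if l = c y then c x else l) ` c ` ends e"
        by (auto simp: c'_def image_image)
      then have "2 \<le> card (c ` ends e)"
        using e card_image_le[of "c ` ends e" "\<lambda>l. if l = c y then c x else l"] finite_ends[of e] by simp
      moreover have "card (c ` ends e) \<le> 2"
        using e card_image_le[of "ends e" c] finite_ends[of e] card_ends[of e] by simp
      ultimately show "e \<in> crossing c" using e by simp
    qed
    have \<mu>0: "\<mu> \<ge> 0" using less.prems e0(1) by (simp add: \<mu>_def)
    have a'0: "0 \<le> a' e" if "e \<in> crossing c" for e
      using e0(2)[OF that] by (simp add: a'_def \<mu>_def)
    have "\<exists>T \<subseteq> crossing c'. card T < card (c' ` terminals m) \<and>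
        I * (\<Sum>e\<in>T. a' e) \<le> (\<Sum>e\<in>crossing c'. a' e) \<and> connects c' T"
      using card' ge2 a'0 sub by (intro less.hyps) auto
    then obtain T where T: "T \<subseteq> crossing c'" "card T < card (c' ` terminals m)"
      "I * (\<Sum>e\<in>T. a' e) \<le> (\<Sum>e\<in>crossing c'. a' e)" "connects c' T"
      by blast
    have finT: "finite T" using T(1) finc finite_subset by blast
    have "c' ` ends e0 = {c x}" using cxy by (auto simp: xy c'_def)
    then have "e0 \<notin> crossing c'" by simp
    then have "e0 \<notin> T" using T(1) by blast
    then have cardT: "card (insert e0 T) < card (c ` terminals m)"
      using finT T(2) card' by simp
    have "(\<Sum>e\<in>T. a' e) = (\<Sum>e\<in>T. a e) - \<mu> * card T"
      by (simp add: a'_def sum_subtractf)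
    then have sumT: "(\<Sum>e\<in>insert e0 T. a e) = (\<Sum>e\<in>T. a' e) + \<mu> * real (card (insert e0 T))"
      using finT \<open>e0 \<notin> T\<close> by (simp add: \<mu>_def algebra_simps)
    \<comment> \<open>The edge count is carried through the induction for this point: with at most
      (colours - 1) edges, the cut condition bounds \<open>I\<close> times their number, which pays
      for the subtracted \<open>\<mu>\<close>.\<close>
    have "real (card (insert e0 T)) \<le> real (card (c ` terminals m)) - 1"
      using cardT by simp
    then have "I * real (card (insert e0 T)) \<le> I * (real (card (c ` terminals m)) - 1)"
      using I by (intro mult_left_mono) auto
    also have "\<dots> \<le> card (crossing c)" by (rule cut)
    finally have "\<mu> * (I * real (card (insert e0 T))) \<le> \<mu> * card (crossing c)"
      using \<mu>0 by (rule mult_left_mono)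
    moreover have "(\<Sum>e\<in>crossing c'. a' e) \<le> (\<Sum>e\<in>crossing c. a' e)"
      using a'0 sub finc by (intro sum_mono2) auto
    moreover have "(\<Sum>e\<in>crossing c. a e) = (\<Sum>e\<in>crossing c. a' e) + \<mu> * card (crossing c)"
      by (simp add: a'_def sum_subtractf)
    ultimately have "I * (\<Sum>e\<in>insert e0 T. a e) \<le> (\<Sum>e\<in>crossing c. a e)"
      using T(3) unfolding sumT by (simp add: algebra_simps)
    moreover have "connects c (insert e0 T)"
      unfolding connects_def
    proof (intro allI impI)
      fix B assume B: "B \<noteq> {} \<and> B \<subset> terminals m \<and>
        (\<forall>v\<in>B. \<forall>w\<in>terminals m. c v = c w \<longrightarrow> w \<in> B)"
      show "\<exists>e\<in>insert e0 T. ends e \<inter> B \<noteq> {} \<and> \<not> ends e \<subseteq> B"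
      proof (cases "\<forall>v\<in>B. \<forall>w\<in>terminals m. c' v = c' w \<longrightarrow> w \<in> B")
        case True
        then have "\<exists>e\<in>T. ends e \<inter> B \<noteq> {} \<and> \<not> ends e \<subseteq> B"
          by (intro mp[OF spec[OF T(4)[unfolded connects_def]]]
              conjI[OF conjunct1[OF B] conjI[OF conjunct1[OF conjunct2[OF B]]]])
        then show ?thesis by blast
      next
        case False
        \<comment> \<open>\<open>B\<close> is closed under \<open>c\<close> but not under
          \<open>c'\<close>, so it separates the two merged classes. It then contains exactly one
          end of \<open>e0\<close>, and \<open>e0\<close> leaves it.\<close>
        then obtain v w where vw: "v \<in> B" "w \<in> terminals m" "c' v = c' w" "w \<notin> B" by blast
        then have "c v \<noteq> c w" using B by blast
        then have "c v = c x \<and> c w = c y \<or> c v = c y \<and> c w = c x"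
          using vw(3) by (auto simp: c'_def split: if_splits)
        moreover have "v \<in> terminals m" using vw(1) B by blast
        ultimately have "x \<in> B \<and> y \<notin> B \<or> y \<in> B \<and> x \<notin> B"
          using B[THEN conjunct2, THEN conjunct2, THEN bspec, THEN bspec, THEN mp] vw xyV by metis
        then show ?thesis using xy by auto
      qed
    qed
    ultimately show ?thesis
      using T(1) sub e0(1) cardT by (intro exI[of _ "insert e0 T"]) auto
  qed
qed

text \<open>A spanning tree, listed in an order in which every edge but the first meets an earlier one.\<close>

definition tree :: "'e list \<Rightarrow> bool" where
  "tree es \<longleftrightarrow> length es = m - 1 \<and> distinct es \<and> set es \<subseteq> E \<and>
    (\<forall>j. 0 < j \<and> j < m - 1 \<longrightarrow> (\<exists>p<j. ends (es ! p) \<inter> ends (es ! j) \<noteq> {})) \<and>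
    terminals m \<subseteq> (\<Union>e\<in>set es. ends e)"

text \<open>Greedy growth: while the covered set is not all of the terminals, the cut condition
  yields an edge leaving it. Such an edge has one end inside and one outside, so
  \<open>k + 1\<close> edges cover \<open>k + 2\<close> terminals.\<close>

lemma connects_imp_tree:
  assumes T: "connects id T" "T \<subseteq> E"
  obtains es where "tree es" "set es \<subseteq> T"
proof -
  have cross: "\<exists>e\<in>T. ends e \<inter> B \<noteq> {} \<and> \<not> ends e \<subseteq> B" if "B \<noteq> {}" "B \<subset> terminals m" for B
    using T(1) that unfolding connects_def by auto
  have ex: "\<exists>es. length es = Suc k \<and> distinct es \<and> set es \<subseteq> T \<and>
      (\<forall>j. 0 < j \<and> j < Suc k \<longrightarrow> (\<exists>p<j. ends (es ! p) \<inter> ends (es ! j) \<noteq> {})) \<and>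
      card (\<Union>e\<in>set es. ends e) = k + 2" if "Suc k < m" for k
    using that
  proof (induction k)
    case 0
    have "card {1::nat} \<noteq> card (terminals m)" using m_ge_2 by simp
    then have "{1} \<noteq> terminals m" by metis
    moreover have "{1} \<subseteq> terminals m" using m_ge_2 by (simp add: terminals_def)
    ultimately obtain e where e: "e \<in> T" using cross[of "{1}"] by blast
    then have "card (ends e) = 2" using T(2) by (intro card_ends) blast
    then show ?case
      using e by (intro exI[of _ "[e]"]) auto
  next
    case (Suc k)
    then obtain es where es: "length es = Suc k" "distinct es" "set es \<subseteq> T"
      "\<And>j. 0 < j \<and> j < Suc k \<Longrightarrow> \<exists>p<j. ends (es ! p) \<inter> ends (es ! j) \<noteq> {}"
      "card (\<Union>e\<in>set es. ends e) = k + 2"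
      by auto
    let ?B = "\<Union>e\<in>set es. ends e"
    have "?B \<subseteq> terminals m" using es(3) T(2) ends_subset by blast
    moreover have "?B \<noteq> terminals m" using es(5) Suc.prems by auto
    moreover have "?B \<noteq> {}" using es(5) by (metis add_is_0 card.empty zero_neq_numeral)
    ultimately obtain e where e: "e \<in> T" "ends e \<inter> ?B \<noteq> {}" "\<not> ends e \<subseteq> ?B"
      using cross[of ?B] by blast
    have fin: "finite ?B" by (rule finite_subset[OF \<open>?B \<subseteq> terminals m\<close> finite_terminals])
    obtain p where p: "p < Suc k" "ends (es ! p) \<inter> ends e \<noteq> {}"
      using e(2) es(1) by (fastforce simp: in_set_conv_nth)
    have eE: "e \<in> E" using e(1) T(2) by auto
    have "card (ends e \<inter> ?B) > 0" "card (ends e - ?B) > 0"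
      using e finite_ends[OF eE] by (auto simp: card_gt_0_iff)
    moreover have "card (ends e \<inter> ?B) + card (ends e - ?B) = 2"
      using card_Int_Diff[OF finite_ends[OF eE], of ?B] card_ends[OF eE] by simp
    ultimately have "card (ends e - ?B) = 1" by linarith
    moreover have "(\<Union>e\<in>set (es @ [e]). ends e) = ?B \<union> (ends e - ?B)" by auto
    ultimately have "card (\<Union>e\<in>set (es @ [e]). ends e) = Suc k + 2"
      using fin finite_ends[OF eE] es(5) by (simp add: card_Un_disjoint del: Un_Diff_cancel)
    moreover have "e \<notin> set es" using e(3) by auto
    moreover have "\<exists>q<j. ends ((es @ [e]) ! q) \<inter> ends ((es @ [e]) ! j) \<noteq> {}"
      if j: "0 < j \<and> j < Suc (Suc k)" for j
    proof (cases "j = Suc k")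
      case True
      then show ?thesis using p es(1) by (intro exI[of _ p]) (auto simp: nth_append)
    next
      case False
      then have "j < Suc k" using j by simp
      then obtain q where "q < j" "ends (es ! q) \<inter> ends (es ! j) \<noteq> {}"
        using es(4)[of j] j by auto
      then show ?thesis using es(1) \<open>j < Suc k\<close> by (intro exI[of _ q]) (auto simp: nth_append)
    qed
    ultimately show ?case
      using es e(1) by (intro exI[of _ "es @ [e]"]) auto
  qed
  have eq: "Suc (m - 2) = m - 1" "m - 2 + 2 = m" "m - 1 < m" using m_ge_2 by auto
  obtain es where es: "length es = m - 1 \<and> distinct es \<and> set es \<subseteq> T \<and>
      (\<forall>j. 0 < j \<and> j < m - 1 \<longrightarrow> (\<exists>p<j. ends (es ! p) \<inter> ends (es ! j) \<noteq> {})) \<and>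
      card (\<Union>e\<in>set es. ends e) = m"
    using ex[of "m - 2", unfolded eq(1,2), OF eq(3)] by (elim exE)
  have card: "card (\<Union>e\<in>set es. ends e) = card (terminals m)"
    unfolding card_terminals using es by (elim conjE)
  have esT: "set es \<subseteq> T" using es by (elim conjE)
  have esE: "set es \<subseteq> E" using esT T(2) by (rule subset_trans)
  then have "(\<Union>e\<in>set es. ends e) \<subseteq> terminals m" using ends_subset by blast
  then have "(\<Union>e\<in>set es. ends e) = terminals m"
    using card by (rule card_subset_eq[OF finite_terminals])
  then have "tree es" using es esE by (simp add: tree_def)
  then show ?thesis using esT by (rule that)
qed

text \<open>For the colouring \<open>id\<close> every edge crosses. Thinning the connecting set to a
  tree does not raise its weight, since weights are nonnegative.\<close>

lemma light_tree:
  assumes "MI E ends m > 0" "\<And>e. e \<in> E \<Longrightarrow> 0 \<le> a e"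
  obtains es where "tree es" "MI E ends m * (\<Sum>e\<in>set es. a e) \<le> (\<Sum>e\<in>E. a e)"
proof -
  have crossing_id: "crossing id = E" using card_ends by auto
  obtain T where T: "T \<subseteq> E" "MI E ends m * (\<Sum>e\<in>T. a e) \<le> (\<Sum>e\<in>E. a e)" "connects id T"
    using light_connecting_set[OF assms(1) MI_le_crossing, of id a] assms(2)
    unfolding crossing_id by blast
  obtain es where es: "tree es" "set es \<subseteq> T" using connects_imp_tree[OF T(3,1)] by blast
  have "(\<Sum>e\<in>set es. a e) \<le> (\<Sum>e\<in>T. a e)"
    using es(2) T(1) assms(2) finite_subset[OF T(1) finite_E] by (intro sum_mono2) auto
  then have "MI E ends m * (\<Sum>e\<in>set es. a e) \<le> MI E ends m * (\<Sum>e\<in>T. a e)"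
    using assms(1) by (intro mult_left_mono) auto
  then show ?thesis using T(2) es(1) that by force
qed

definition load :: "'e list list \<Rightarrow> 'e \<Rightarrow> nat" where
  "load ts e = length (filter (\<lambda>es. e \<in> set es) ts)"

definition tree_packing :: "nat \<Rightarrow> 'e list list \<Rightarrow> bool" where
  "tree_packing n ts \<longleftrightarrow> (\<forall>es\<in>set ts. tree es) \<and> (\<forall>e\<in>E. load ts e \<le> n)"

text \<open>Multiplicative weights: each new tree is light for weights exponential in the current load.\<close>

lemma multiplicative_weights:
  assumes I: "MI E ends m > 0" and \<eta>: "\<eta> > 0"
  shows "\<exists>ts. length ts = N \<and> (\<forall>es\<in>set ts. tree es) \<and>
    (\<Sum>e\<in>E. (1 + \<eta>) ^ load ts e) \<le> card E * (1 + \<eta> / MI E ends m) ^ N"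
proof (induction N)
  case 0
  then show ?case by (simp add: load_def)
next
  case (Suc N)
  then obtain ts where ts: "length ts = N" "\<forall>es\<in>set ts. tree es"
    "(\<Sum>e\<in>E. (1 + \<eta>) ^ load ts e) \<le> card E * (1 + \<eta> / MI E ends m) ^ N" by blast
  define a where "a e = (1 + \<eta>) ^ load ts e" for e
  obtain es where es: "tree es" "MI E ends m * (\<Sum>e\<in>set es. a e) \<le> (\<Sum>e\<in>E. a e)"
    by (rule light_tree[OF I, of a]) (use \<eta> in \<open>auto simp: a_def\<close>)
  have sub: "set es \<subseteq> E" using es(1) by (simp add: tree_def)
  \<comment> \<open>A new tree multiplies the weights of its own edges by \<open>1 + \<eta>\<close>.
    As the tree is light, the total grows at most by the factor
    \<open>1 + \<eta> / I\<close>.\<close>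
  have "(\<Sum>e\<in>E. (1 + \<eta>) ^ load (es # ts) e) = (\<Sum>e\<in>E. a e + (if e \<in> set es then \<eta> * a e else 0))"
    by (intro sum.cong) (auto simp: load_def a_def algebra_simps)
  also have "\<dots> = (\<Sum>e\<in>E. a e) + \<eta> * (\<Sum>e\<in>set es. a e)"
    using finite_E sub by (simp add: sum.distrib sum.If_cases Int_absorb1 sum_distrib_left)
  also have "\<dots> \<le> (\<Sum>e\<in>E. a e) + \<eta> * ((\<Sum>e\<in>E. a e) / MI E ends m)"
    using es(2) I \<eta> by (intro add_left_mono mult_left_mono) (auto simp: field_simps)
  also have "\<dots> = (\<Sum>e\<in>E. a e) * (1 + \<eta> / MI E ends m)" by (simp add: algebra_simps)
  also have "\<dots> \<le> card E * (1 + \<eta> / MI E ends m) ^ N * (1 + \<eta> / MI E ends m)"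
    using ts(3) I \<eta> by (intro mult_right_mono) (auto simp: a_def)
  finally show ?case
    using ts es by (intro exI[of _ "es # ts"]) (auto simp: algebra_simps)
qed

text \<open>A single weight is at most their sum, so every load times \<open>ln (1 + \<eta>)\<close>
  is at most \<open>ln (card E) + N * \<eta> / I\<close>. For \<open>N\<close> close to
  \<open>n * (I - \<epsilon>)\<close> this falls short of \<open>n * ln (1 + \<eta>)\<close> by
  \<open>n * \<delta>\<close> up to constants. The upper bound on the length later limits the
  communication rate.\<close>

lemma eventually_tree_packing:
  assumes \<epsilon>: "\<epsilon> > 0" "\<epsilon> < MI E ends m"
  shows "\<forall>\<^sub>F n in sequentially. \<exists>ts. tree_packing n ts \<and>
    n * (MI E ends m - \<epsilon>) \<le> length ts \<and> length ts \<le> n * MI E ends m"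
proof -
  define I where "I = MI E ends m"
  have I: "I > 0" "\<epsilon> < I" using \<epsilon> by (auto simp: I_def)
  \<comment> \<open>Small enough that the second-order loss \<open>\<eta> * \<eta>\<close> in
    \<open>ln (1 + \<eta>)\<close> stays below the gain
    \<open>\<eta> * \<epsilon> / I\<close>.\<close>
  define \<eta> where "\<eta> = \<epsilon> / (2 * I)"
  have \<eta>: "\<eta> > 0" "\<eta> < 1" using \<epsilon> I by (auto simp: \<eta>_def field_simps)
  define \<delta> where "\<delta> = ln (1 + \<eta>) - \<eta> * (1 - \<epsilon> / I)"
  have "\<eta> * \<eta> < \<eta> * (\<epsilon> / I)"
    using \<eta> \<epsilon> I by (intro mult_strict_left_mono) (auto simp: \<eta>_def field_simps)
  moreover have "\<eta> - \<eta>\<^sup>2 \<le> ln (1 + \<eta>)"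
    using \<eta> by (intro ln_one_plus_pos_lower_bound) auto
  ultimately have \<delta>: "\<delta> > 0" by (simp add: \<delta>_def power2_eq_square algebra_simps)
  have "\<forall>\<^sub>F n in sequentially. real n > (ln (card E) + \<eta> / I) / \<delta>"
    "\<forall>\<^sub>F n in sequentially. real n > 1 / \<epsilon>"
    using filterlim_real_sequentially by (simp_all add: filterlim_at_top_dense)
  then show ?thesis
  proof eventually_elim
    case (elim n)
    have n1: "ln (card E) + \<eta> / I \<le> n * \<delta>" using elim(1) \<delta> by (simp add: field_simps)
    have n2: "1 \<le> n * \<epsilon>" using elim(2) \<epsilon> by (simp add: field_simps)
    \<comment> \<open>Rounding up overshoots by at most one tree, which \<open>n2\<close> keeps
      within \<open>n * I\<close>.\<close>
    define N where "N = nat \<lceil>n * (I - \<epsilon>)\<rceil>"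
    have N: "n * (I - \<epsilon>) \<le> N" "N \<le> n * (I - \<epsilon>) + 1"
      using I by (auto simp: N_def)
    obtain ts where ts: "length ts = N" "\<forall>es\<in>set ts. tree es"
      "(\<Sum>e\<in>E. (1 + \<eta>) ^ load ts e) \<le> card E * (1 + \<eta> / I) ^ N"
      using multiplicative_weights[of \<eta> N] I \<eta> unfolding I_def by blast
    have "load ts e \<le> n" if e: "e \<in> E" for e
    proof -
      have E0: "card E > 0" using e finite_E by (auto simp: card_gt_0_iff)
      have "(1 + \<eta>) ^ load ts e \<le> (\<Sum>e\<in>E. (1 + \<eta>) ^ load ts e)"
        using e finite_E \<eta> by (intro member_le_sum) auto
      also note ts(3)
      finally have "ln ((1 + \<eta>) ^ load ts e) \<le> ln (card E * (1 + \<eta> / I) ^ N)"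
        using \<eta> I E0 by (subst ln_le_cancel_iff) (auto intro!: mult_pos_pos zero_less_power add_pos_pos)
      moreover have "1 + \<eta> / I > 0" using \<eta> I by (simp add: add_pos_pos)
      ultimately have "load ts e * ln (1 + \<eta>) \<le> ln (card E) + N * ln (1 + \<eta> / I)"
        using \<eta> E0 by (simp add: ln_realpow ln_mult)
      also have "\<dots> \<le> ln (card E) + (n * (I - \<epsilon>) + 1) * (\<eta> / I)"
        using N \<eta> I ln_add_one_self_le_self[of "\<eta> / I"] by (intro add_left_mono mult_mono) auto
      also have "\<dots> = ln (card E) + \<eta> / I + n * (\<eta> * (1 - \<epsilon> / I))"
        using I by (simp add: field_simps)
      also have "\<dots> \<le> n * ln (1 + \<eta>)"
        using n1 by (simp add: \<delta>_def algebra_simps)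
      finally show ?thesis using \<eta> by simp
    qed
    moreover have "N \<le> n * I" using N(2) n2 by (simp add: algebra_simps)
    ultimately show ?case
      using ts(1,2) N(1) unfolding tree_packing_def I_def[symmetric] by blast
  qed
qed

text \<open>\<open>SK_achievable\<close> fixes the protocols before \<open>\<epsilon>\<close>, so
  one sequence has to serve all \<open>\<epsilon>\<close>. A longest packing with at most
  \<open>n * I\<close> trees, chosen for each \<open>n\<close>, is at least as long as every packing
  built for a particular \<open>\<epsilon>\<close>.\<close>

lemma tree_packings:
  obtains ts where "\<And>n. tree_packing n (ts n)" "\<And>n. length (ts n) \<le> n * MI E ends m"
    "\<And>\<epsilon>. \<epsilon> > 0 \<Longrightarrow> \<forall>\<^sub>F n in sequentially. n * (MI E ends m - \<epsilon>) \<le> length (ts n)"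
proof -
  define I where "I = MI E ends m"
  define P where "P n ts \<longleftrightarrow> tree_packing n ts \<and> length ts \<le> n * I" for n ts
  have I: "I \<ge> 0" using MI_nonneg by (simp add: I_def)
  have "\<exists>ts. P n ts \<and> (\<forall>ts'. P n ts' \<longrightarrow> length ts' \<le> length ts)" for n
  proof -
    have "P n []" using I by (simp add: P_def tree_packing_def load_def)
    moreover have "\<forall>ts. P n ts \<longrightarrow> length ts < Suc (nat \<lfloor>n * I\<rfloor>)"
      by (auto simp: P_def le_nat_floor less_Suc_eq_le)
    ultimately show ?thesis by (rule ex_has_greatest_nat)
  qed
  then obtain ts where ts: "\<And>n. P n (ts n)" "\<And>n ts'. P n ts' \<Longrightarrow> length ts' \<le> length (ts n)"
    by metis
  have "\<forall>\<^sub>F n in sequentially. n * (I - \<epsilon>) \<le> length (ts n)" if \<epsilon>: "\<epsilon> > 0" for \<epsilon>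
  proof (cases "\<epsilon> < I")
    case True
    have "\<forall>\<^sub>F n in sequentially. \<exists>ts'. tree_packing n ts' \<and> n * (I - \<epsilon>) \<le> length ts' \<and> length ts' \<le> n * I"
      using eventually_tree_packing[of \<epsilon>] \<epsilon> True by (simp add: I_def)
    then show ?thesis
    proof eventually_elim
      case (elim n)
      then obtain ts' where "P n ts'" "n * (I - \<epsilon>) \<le> length ts'" by (auto simp: P_def)
      then show ?case using ts(2) by force
    qed
  next
    case False
    \<comment> \<open>Here the required length is not positive; this also covers
      \<open>I = 0\<close>, where no tree need exist.\<close>
    then have "n * (I - \<epsilon>) \<le> length (ts n)" for n
      by (intro order_trans[OF mult_nonneg_nonpos]) auto
    then show ?thesis by simp
  qed
  then show ?thesis using ts(1) that[of ts] by (auto simp: P_def I_def)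
qed

section \<open>Secret keys from a tree packing\<close>

lemma run_noninteractive:
  "run E ends n (map (\<lambda>x. (s x, \<lambda>y _. g x y)) xs) xi acc = acc @ map (\<lambda>x. g x (obs E ends n {s x} xi)) xs"
  by (induction xs arbitrary: acc) auto

lemma load_take_mono: "a \<le> b \<Longrightarrow> load (take a ts) e \<le> load (take b ts) e"
  using take_add[of a "b - a" ts] by (simp add: load_def)

lemma load_take_Suc: "t < length ts \<Longrightarrow> e \<in> set (ts ! t) \<Longrightarrow> load (take (Suc t) ts) e = Suc (load (take t ts) e)"
  by (simp add: load_def take_Suc_conv_app_nth)

lemma load_take_le: "load (take a ts) e \<le> load ts e"
  using load_take_mono[of a "max a (length ts)" ts e] by simp

text \<open>Every use of an edge by a tree gets its own copy; the other edges of a tree are announced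
  xored with an earlier adjacent edge of the tree, and the bits on the first edges form the key.\<close>

lemma packing_SK:
  assumes ts: "tree_packing n ts"
  obtains F :: "'e protocol" and K :: "'e sample \<Rightarrow> nat" and J :: "nat \<Rightarrow> 'e sample \<Rightarrow> nat list \<Rightarrow> nat"
  where "valid_protocol m F"
    "log 2 (card (transcript E ends n F ` sample_space E n)) \<le> (real m - 2) * length ts"
    "\<And>xi i. xi \<in> sample_space E n \<Longrightarrow> i \<in> terminals m \<Longrightarrow>
      J i (obs E ends n {i} xi) (transcript E ends n F xi) = K xi"
    "mut_info (sample_space E n) K (transcript E ends n F) \<le> 0"
    "ent (sample_space E n) K = length ts"
proof -
  define N where "N = length ts"
  \<comment> \<open>Tree \<open>t\<close> uses the copy of an edge whose index is the number of
    earlier trees containing that edge. Thus no copy is used twice, and the load bound keeps the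
    index below \<open>n\<close>.\<close>
  define slot where "slot t j = (ts ! t ! j, load (take t ts) (ts ! t ! j))" for t j
  have tree: "tree (ts ! t)" if "t < N" for t
    using ts that by (simp add: tree_packing_def N_def)
  have edge: "ts ! t ! j \<in> set (ts ! t)" "ts ! t ! j \<in> E" if "t < N" "j < m - 1" for t j
    using tree[OF that(1)] that(2) nth_mem[of j "ts ! t"] by (auto simp: tree_def)
  have slot_in: "slot t j \<in> E \<times> {..<n}" if t: "t < N" "j < m - 1" for t j
  proof -
    have "load (take t ts) (ts ! t ! j) < load (take (Suc t) ts) (ts ! t ! j)"
      using t edge(1)[OF t] by (simp add: load_take_Suc N_def)
    also have "\<dots> \<le> load ts (ts ! t ! j)" by (rule load_take_le)
    also have "\<dots> \<le> n" using ts edge(2)[OF t] by (simp add: tree_packing_def)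
    finally show ?thesis using edge(2)[OF t] by (simp add: slot_def)
  qed
  have slot_less: "slot t j \<noteq> slot t' j'" if "t < N" "j < m - 1" "t < t'" for t j t' j'
  proof
    assume eq: "slot t j = slot t' j'"
    have "load (take t ts) (ts ! t ! j) < load (take (Suc t) ts) (ts ! t ! j)"
      using that edge(1)[of t j] by (simp add: load_take_Suc N_def)
    also have "\<dots> \<le> load (take t' ts) (ts ! t ! j)"
      using that by (intro load_take_mono) simp
    finally show False using eq unfolding slot_def prod.inject by (metis less_irrefl)
  qed
  have slot_inj: "t = t' \<and> j = j'"
    if "slot t j = slot t' j'" "t < N" "j < m - 1" "t' < N" "j' < m - 1" for t j t' j'
  proof -
    have "t = t'"
      using slot_less[of t j t' j'] slot_less[of t' j' t j] that by (metis linorder_neqE_nat)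
    moreover have "j = j'"
      using that tree[of t] \<open>t = t'\<close> by (auto simp: slot_def tree_def nth_eq_iff_index_eq)
    ultimately show ?thesis by simp
  qed
  \<comment> \<open>The common endpoint \<open>vtx\<close> sees both bits and can therefore announce
    their xor.\<close>
  have "\<exists>p v. p < j \<and> v \<in> ends (ts ! t ! p) \<and> v \<in> ends (ts ! t ! j)" if "t < N" "0 < j" "j < m - 1" for t j
    using tree[OF that(1)] that(2,3) unfolding tree_def by blast
  then obtain par vtx where par: "\<And>t j. t < N \<Longrightarrow> 0 < j \<Longrightarrow> j < m - 1 \<Longrightarrow>
      par t j < j \<and> vtx t j \<in> ends (ts ! t ! par t j) \<and> vtx t j \<in> ends (ts ! t ! j)"
    by metis
  \<comment> \<open>Position \<open>0\<close> is left out because its bit is the key bit;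
    \<open>m - 2\<close> announcements per tree remain.\<close>
  define xs where "xs = List.product [0..<N] [1..<m - 1]"
  have xs: "(t, j) \<in> set xs \<longleftrightarrow> t < N \<and> 0 < j \<and> j < m - 1" for t j
    by (auto simp: xs_def)
  define msg :: "nat \<times> nat \<Rightarrow> 'e sample \<Rightarrow> nat" where
    "msg = (\<lambda>(t, j) y. of_bool (y (slot t j) \<noteq> y (slot t (par t j))))"
  define F :: "'e protocol" where "F = map (\<lambda>x. (case x of (t, j) \<Rightarrow> vtx t j, \<lambda>y _. msg x y)) xs"
  define T where "T = transcript E ends n F"
  have T: "T xi = map (\<lambda>x. msg x xi) xs" for xi
    unfolding T_def transcript_def F_def run_noninteractive append_Nil
  proof (intro map_cong refl)
    fix x assume x_in: "x \<in> set xs"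
    obtain t j where "x = (t, j)" by (rule prod.exhaust)
    then have x: "x = (t, j)" "t < N" "0 < j" "j < m - 1" using x_in by (simp_all add: xs)
    have "par t j < m - 1" using par[OF x(2-4)] x(4) by simp
    then have "slot t j \<in> copies E ends n {vtx t j}" "slot t (par t j) \<in> copies E ends n {vtx t j}"
      using par[OF x(2-4)] slot_in[OF x(2,4)] slot_in[OF x(2), of "par t j"]
      by (auto simp: copies_def slot_def)
    then show "msg x (obs E ends n {case x of (t, j) \<Rightarrow> vtx t j} xi) = msg x xi"
      by (simp add: x(1) msg_def obs_def)
  qed
  \<comment> \<open>Equal transcripts fix all xors along a tree, so two samples differ on all of its
    slots or on none.\<close>
  have propagate: "(xi (slot t j) \<noteq> xi' (slot t j)) = (xi (slot t 0) \<noteq> xi' (slot t 0))"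
    if eq: "T xi = T xi'" and t: "t < N" and "j < m - 1" for xi xi' t j
    using that(3)
  proof (induction j rule: less_induct)
    case (less j)
    show ?case
    proof (cases "j = 0")
      case False
      then have p: "par t j < j" using par[of t j] t less.prems by simp
      have "(t, j) \<in> set xs" using False t less.prems by (simp add: xs)
      then have "msg (t, j) xi = msg (t, j) xi'" using eq by (simp add: T)
      then have "(xi (slot t j) \<noteq> xi (slot t (par t j))) = (xi' (slot t j) \<noteq> xi' (slot t (par t j)))"
        by (simp add: msg_def of_bool_eq_iff)
      then show ?thesis using less.IH[OF p] p less.prems by auto
    qed simp
  qed
  define K where "K xi = (to_nat (map (\<lambda>t. xi (slot t 0)) [0..<N]) :: nat)" for xi :: "'e sample"
  have K_eq: "K xi = K xi' \<longleftrightarrow> (\<forall>t<N. xi (slot t 0) = xi' (slot t 0))" for xi xi'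
    by (auto simp: K_def inj_eq[OF inj_to_nat])
  \<comment> \<open>The decoder takes any sample consistent with its view and the transcript. Every
    tree has an edge at \<open>i\<close>, so by \<open>propagate\<close> all consistent samples have
    the same key.\<close>
  define J where "J i y f = K (SOME xi. xi \<in> sample_space E n \<and> obs E ends n {i} xi = y \<and> T xi = f)" for i y f
  have J: "J i (obs E ends n {i} xi) (T xi) = K xi" if xi: "xi \<in> sample_space E n" "i \<in> terminals m" for xi i
  proof -
    define xi' where "xi' = (SOME xi'. xi' \<in> sample_space E n \<and> obs E ends n {i} xi' = obs E ends n {i} xi \<and> T xi' = T xi)"
    have xi': "obs E ends n {i} xi' = obs E ends n {i} xi" "T xi' = T xi"
      using someI[of "\<lambda>xi'. xi' \<in> sample_space E n \<and> obs E ends n {i} xi' = obs E ends n {i} xi \<and> T xi' = T xi" xi] xi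
      by (auto simp: xi'_def)
    have "xi' (slot t 0) = xi (slot t 0)" if t: "t < N" for t
    proof -
      obtain j where j: "j < m - 1" "i \<in> ends (ts ! t ! j)"
      proof -
        obtain e where "e \<in> set (ts ! t)" "i \<in> ends e"
          using tree[OF t] xi(2) unfolding tree_def by blast
        then show ?thesis
          using tree[OF t] that unfolding tree_def by (metis in_set_conv_nth)
      qed
      have "slot t j \<in> copies E ends n {i}"
        using slot_in[OF t j(1)] j(2) by (auto simp: copies_def slot_def)
      then have "xi' (slot t j) = xi (slot t j)"
        using xi'(1) by (simp add: obs_eq_res res_eq_iff)
      then show ?thesis using propagate[OF xi'(2) t j(1)] by simp
    qed
    then show ?thesis unfolding J_def xi'_def[symmetric] K_eq by simp
  qed
  have m1: "0 < m - 1" using m_ge_2 by simp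
  have lenF: "log 2 (card (T ` sample_space E n)) \<le> (real m - 2) * N"
  proof -
    have len: "length xs = N * (m - 2)" by (simp add: xs_def numeral_2_eq_2)
    have "T ` sample_space E n \<subseteq> {l. set l \<subseteq> {0, 1} \<and> length l = N * (m - 2)}"
      by (auto simp: T len msg_def split: prod.splits)
    then have "card (T ` sample_space E n) \<le> card {l. set l \<subseteq> {0, 1 :: nat} \<and> length l = N * (m - 2)}"
      by (intro card_mono finite_lists_length_eq) auto
    also have "\<dots> = 2 ^ (N * (m - 2))" by (simp add: card_lists_length_eq numeral_2_eq_2)
    finally have "real (card (T ` sample_space E n)) \<le> 2 ^ (N * (m - 2))"
      by (metis of_nat_le_iff of_nat_numeral of_nat_power)
    moreover have "card (T ` sample_space E n) > 0"
      using finite_sample sample_space_nonempty by (simp add: card_gt_0_iff)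
    ultimately have "log 2 (card (T ` sample_space E n)) \<le> log 2 (2 ^ (N * (m - 2)))"
      by (subst log_le_cancel_iff) auto
    also have "\<dots> = (real m - 2) * N" using m_ge_2 by (simp add: log_nat_power of_nat_diff)
    finally show ?thesis .
  qed
  have ent_slots: "ent (sample_space E n) (res ((\<lambda>(t, j). slot t j) ` S)) = card S"
    if "S \<subseteq> {..<N} \<times> {..<m - 1}" for S
  proof -
    have "inj_on (\<lambda>(t, j). slot t j) S"
    proof (rule inj_onI)
      fix x y assume xy: "x \<in> S" "y \<in> S" "(case x of (t, j) \<Rightarrow> slot t j) = (case y of (t, j) \<Rightarrow> slot t j)"
      show "x = y"
        using subsetD[OF that xy(1)] subsetD[OF that xy(2)] xy(3) slot_inj[of "fst x" "snd x" "fst y" "snd y"]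
        by (simp add: split_beta mem_Times_iff prod_eq_iff)
    qed
    moreover have "(\<lambda>(t, j). slot t j) ` S \<subseteq> E \<times> {..<n}"
    proof
      fix y assume "y \<in> (\<lambda>(t, j). slot t j) ` S"
      then obtain t j where "y = slot t j" "(t, j) \<in> S" by auto
      then show "y \<in> E \<times> {..<n}" using slot_in[of t j] subsetD[OF that, of "(t, j)"] by simp
    qed
    ultimately show ?thesis by (simp add: ent_res[OF finite_E] card_image)
  qed
  have entK: "ent (sample_space E n) K = N"
  proof -
    have "ent (sample_space E n) K = ent (sample_space E n) (res ((\<lambda>(t, j). slot t j) ` ({..<N} \<times> {0})))"
      by (rule ent_cong[OF finite_sample]) (auto simp: K_eq res_eq_iff)
    also have "\<dots> = card ({..<N} \<times> {0::nat})" using m1 by (intro ent_slots) auto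
    finally show ?thesis by (simp add: card_cartesian_product)
  qed
  \<comment> \<open>Key and transcript determine all \<open>N * (m - 1)\<close> slot bits, while
    \<open>H K = N\<close> and \<open>H T\<close> is at most \<open>N * (m - 2)\<close>. Hence no
    mutual information is left.\<close>
  have "real N * (real m - 1) = ent (sample_space E n) (res ((\<lambda>(t, j). slot t j) ` ({..<N} \<times> {..<m - 1})))"
    using m_ge_2 by (subst ent_slots) (auto simp: card_cartesian_product of_nat_diff)
  also have "\<dots> \<le> ent (sample_space E n) (\<lambda>xi. (K xi, T xi))"
  proof (rule ent_mono[OF finite_sample])
    fix xi xi' assume "(K xi, T xi) = (K xi', T xi')"
    then have "xi (slot t j) = xi' (slot t j)" if "t < N" "j < m - 1" for t j
      using propagate[of xi xi' t j] that by (simp add: K_eq)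
    then show "res ((\<lambda>(t, j). slot t j) ` ({..<N} \<times> {..<m - 1})) xi =
      res ((\<lambda>(t, j). slot t j) ` ({..<N} \<times> {..<m - 1})) xi'"
      by (auto simp: res_eq_iff)
  qed
  finally have joint: "real N * (real m - 1) \<le> ent (sample_space E n) (\<lambda>xi. (K xi, T xi))" .
  have "ent (sample_space E n) T \<le> log 2 (card (T ` sample_space E n))"
    using finite_sample by (intro ent_le_log_card sample_space_nonempty) auto
  then have "mut_info (sample_space E n) K T \<le> 0"
    using lenF joint entK by (simp add: mut_info_def algebra_simps)
  moreover have "valid_protocol m F"
    unfolding valid_protocol_def
  proof
    fix s assume "s \<in> set F"
    then obtain t j where "fst s = vtx t j" "t < N" "0 < j" "j < m - 1"
      by (auto simp: F_def xs)
    then show "fst s \<in> terminals m"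
      using par[of t j] edge(2)[of t j] ends_subset by auto
  qed
  ultimately show ?thesis
    using that[of F J K] J lenF entK by (simp add: T_def N_def)
qed

text \<open>Recovery is errorless and leakage is zero at every \<open>n\<close>; only the key rate
  is asymptotic.\<close>

lemma SK_achievable_tree_packing: "SK_achievable E ends m ((real m - 2) * MI E ends m)"
proof -
  let ?I = "MI E ends m"
  obtain ts where ts: "\<And>n. tree_packing n (ts n)" "\<And>n. length (ts n) \<le> n * ?I"
    "\<And>\<epsilon>. \<epsilon> > 0 \<Longrightarrow> \<forall>\<^sub>F n in sequentially. n * (?I - \<epsilon>) \<le> length (ts n)"
    using tree_packings by blast
  have "\<exists>(F :: 'e protocol) (K :: 'e sample \<Rightarrow> nat) J. valid_protocol m F \<and>
    log 2 (card (transcript E ends n F ` sample_space E n)) \<le> (real m - 2) * length (ts n) \<and>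
    (\<forall>xi\<in>sample_space E n. \<forall>i\<in>terminals m.
      J i (obs E ends n {i} xi) (transcript E ends n F xi) = K xi) \<and>
    mut_info (sample_space E n) K (transcript E ends n F) \<le> 0 \<and>
    ent (sample_space E n) K = length (ts n)" for n
    by (rule packing_SK[OF ts(1)[of n]]) blast
  then obtain Fs Js and Ks :: "nat \<Rightarrow> 'e sample \<Rightarrow> nat"
    where valid: "\<And>n. valid_protocol m (Fs n)"
      and rate: "\<And>n. log 2 (card (transcript E ends n (Fs n) ` sample_space E n)) \<le> (real m - 2) * length (ts n)"
      and rec: "\<And>n xi. xi \<in> sample_space E n \<Longrightarrow> \<forall>i\<in>terminals m.
        Js n i (obs E ends n {i} xi) (transcript E ends n (Fs n) xi) = Ks n xi"
      and secret: "\<And>n. mut_info (sample_space E n) (Ks n) (transcript E ends n (Fs n)) \<le> 0"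
      and key: "\<And>n. ent (sample_space E n) (Ks n) = length (ts n)"
    by metis
  show ?thesis
    unfolding SK_achievable_def
  proof (intro exI conjI allI impI)
    show "valid_protocol m (Fs n)" for n by (rule valid)
    fix \<epsilon> :: real assume \<epsilon>: "\<epsilon> > 0"
    show "\<forall>\<^sub>F n in sequentially.
        log 2 (real (card (transcript E ends n (Fs n) ` sample_space E n))) / real n \<le> (real m - 2) * ?I + \<epsilon>
      \<and> 1 - \<epsilon> \<le> unif_prob (sample_space E n)
          (\<lambda>xi. \<forall>i\<in>terminals m. Js n i (obs E ends n {i} xi) (transcript E ends n (Fs n) xi) = Ks n xi)
      \<and> mut_info (sample_space E n) (Ks n) (transcript E ends n (Fs n)) \<le> \<epsilon>
      \<and> ?I - \<epsilon> \<le> ent (sample_space E n) (Ks n) / real n"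
      using ts(3)[OF \<epsilon>] eventually_gt_at_top[of 0]
    proof eventually_elim
      case (elim n)
      let ?T = "transcript E ends n (Fs n)"
      have "log 2 (card (?T ` sample_space E n)) \<le> (real m - 2) * (n * ?I)"
        using rate[of n] mult_left_mono[OF ts(2)[of n], of "real m - 2"] m_ge_2 by simp
      then have "log 2 (card (?T ` sample_space E n)) / n \<le> (real m - 2) * ?I"
        using elim by (simp add: field_simps)
      moreover have "unif_prob (sample_space E n)
          (\<lambda>xi. \<forall>i\<in>terminals m. Js n i (obs E ends n {i} xi) (?T xi) = Ks n xi) = 1"
      proof -
        have "{xi \<in> sample_space E n. \<forall>i\<in>terminals m. Js n i (obs E ends n {i} xi) (?T xi) = Ks n xi} =
          sample_space E n"
          using rec by blast
        then show ?thesis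
          using finite_sample sample_space_nonempty by (simp add: unif_prob_def card_eq_0_iff)
      qed
      moreover have "?I - \<epsilon> \<le> ent (sample_space E n) (Ks n) / n"
        using elim key[of n] by (simp add: field_simps)
      ultimately show ?case using secret[of n] \<epsilon> by simp
    qed
  qed
qed

lemma R_SK_eq: "R_SK E ends m = (real m - 2) * MI E ends m"
  unfolding R_SK_def
proof (rule cInf_eq_minimum)
  show "(real m - 2) * MI E ends m \<in> {R. 0 \<le> R \<and> SK_achievable E ends m R}"
    using SK_achievable_tree_packing MI_nonneg m_ge_2 by simp
qed (use SK_achievable_ge in auto)

end

theorem theorem3:
  fixes m :: nat and E :: "'e set" and ends :: "'e \<Rightarrow> nat set"
  assumes "m \<ge> 2"
    and "finite E"
    and "\<forall>e\<in>E. ends e \<subseteq> terminals m \<and> card (ends e) = 2"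
  shows "RSK_maximal E ends m \<longleftrightarrow> type_S E ends m"
proof -
  interpret pin_graph m E ends
    using assms by unfold_locales auto
  show ?thesis
  proof
    assume "type_S E ends m"
    then show "RSK_maximal E ends m"
      using R_CO_ge R_CO_type_S_le
      by (simp add: RSK_maximal_def R_SK_eq type_S_iff algebra_simps)
  next
    \<comment> \<open>Now \<open>(m - 2) * I = R_CO\<close> is at least \<open>card E - I\<close>,
      which reverses \<open>MI_times_le\<close>.\<close>
    assume "RSK_maximal E ends m"
    then show "type_S E ends m"
      using R_CO_ge MI_times_le
      by (simp add: RSK_maximal_def R_SK_eq type_S_iff algebra_simps)
  qed
qed

end
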